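(* Let $G$ be a finite directed graph such that the undirected graph $\nabla G$ contains a cycle. Then the stable composite state problem ("given a CFSM protocol $\mathbf P$ with communication graph $G$ and a composite state $S$ of $\mathbf P$, is $S$ stable?") is algorithmically undecidable for CFSM protocols with communication graph $G$.
   Context: For a directed graph $G$, $\nabla G$ denotes the corresponding undirected (multi)graph obtained by forgetting edge orientations (parallel edges are kept, so e.g. two opposite edges between the same two nodes form a cycle). A CFSM protocol $\mathbf P$ with communication graph $G=(N,E)$ (each edge $\xi$ has tail $-\xi$ and head $+\xi$) consists of pairwise disjoint finite message sets $M_\xi$, $\xi\in E$, and for each $j\in N$ a finite state machine $F_j=(K_j,\Sigma_j,T_j,h_j)$ with finite state set $K_j$, initial state $h_j$, alphabet $\Sigma_j=\{+b: b\in M_\xi,\ j=+\xi\}\cup\{-b: b\in M_\xi,\ j=-\xi\}$ and transitions $T_j\subseteq K_j\times\Sigma_j\times K_j$ ($+b$ = receive, $-b$ = send). A composite state is $S=(p_j:j\in N)$, $p_j\in K_j$; a channel content is $C=(x_\xi:\xi\in E)$, $x_\xi\in M_\xi^*$; global states are pairs $(S,C)$; $C^0$ has all components empty and the initial global state is $((h_j:j\in N),C^0)$. A step: some machine $F_i$ takes a transition $p_i\xrightarrow{-b}q_i$ with $b\in M_\beta$, $i=-\beta$, and $b$ is appended to the end of $x_\beta$; or takes $p_i\xrightarrow{+b}q_i$ with $b\in M_\beta$, $i=+\beta$, where $x_\beta$ begins with $b$ and this first symbol is removed; all other machine states and channels are unchanged. A composite state $S$ is stable if the global state $(S,C^0)$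 is reachable from the initial global state by finitely many steps. *)

theory Defs
  imports Main "HOL-Library.Nat_Bijection"
begin

datatype recf =
    RZero
  | RSucc
  | RProj nat
  | RComp recf "recf list"
  | RPrim recf recf
  | RMin recf

inductive reval :: "recf \<Rightarrow> nat list \<Rightarrow> nat \<Rightarrow> bool" where
  reval_zero: "reval RZero xs 0"
| reval_succ: "reval RSucc (x # xs) (Suc x)"
| reval_proj: "i < length xs \<Longrightarrow> reval (RProj i) xs (xs ! i)"
| reval_comp: "list_all2 (\<lambda>g y. reval g xs y) gs ys \<Longrightarrow> reval f ys z
     \<Longrightarrow> reval (RComp f gs) xs z"
| reval_prim0: "reval f xs z \<Longrightarrow> reval (RPrim f g) (0 # xs) z"
| reval_primS: "reval (RPrim f g) (n # xs) y \<Longrightarrow> reval g (y # n # xs) z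
     \<Longrightarrow> reval (RPrim f g) (Suc n # xs) z"
| reval_min: "reval f (n # xs) 0 \<Longrightarrow> (\<forall>k<n. \<exists>y. y \<noteq> 0 \<and> reval f (k # xs) y)
     \<Longrightarrow> reval (RMin f) xs n"

definition decidable_on :: "('a \<Rightarrow> nat) \<Rightarrow> ('a \<Rightarrow> bool) \<Rightarrow> ('a \<Rightarrow> bool) \<Rightarrow> bool" where
  "decidable_on enc Adm Q \<longleftrightarrow>
     (\<exists>f. \<forall>x. Adm x \<longrightarrow> reval f [enc x] (if Q x then 1 else 0))"

text \<open>A finite directed multigraph with node set {0..<n} and edges 0..<length es;
  edge k has tail fst (es!k) and head snd (es!k).\<close>

definition graph_ok :: "nat \<Rightarrow> (nat \<times> nat) list \<Rightarrow> bool" where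
  "graph_ok n es \<longleftrightarrow> (\<forall>(a, b) \<in> set es. a < n \<and> b < n)"

text \<open>A cycle in the undirected multigraph obtained by forgetting orientations:
  a nonempty list of pairwise distinct edges cs, and vertices vs with
  vs!0 = vs!(length cs), the vertices vs!0..vs!(length cs - 1) pairwise distinct,
  and edge cs!k joining vs!k and vs!(k+1) (in either orientation).
  Self-loops (length 1) and pairs of parallel edges (length 2) are cycles.\<close>

definition undirected_cycle :: "(nat \<times> nat) list \<Rightarrow> nat list \<Rightarrow> nat list \<Rightarrow> bool" where
  "undirected_cycle es cs vs \<longleftrightarrow>
     cs \<noteq> [] \<and> distinct cs \<and> (\<forall>c \<in> set cs. c < length es) \<and>
     length vs = Suc (length cs) \<and> vs ! 0 = vs ! length cs \<and> distinct (butlast vs) \<and>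
     (\<forall>k < length cs. es ! (cs ! k) = (vs ! k, vs ! Suc k) \<or>
                      es ! (cs ! k) = (vs ! Suc k, vs ! k))"

definition has_undirected_cycle :: "(nat \<times> nat) list \<Rightarrow> bool" where
  "has_undirected_cycle es \<longleftrightarrow> (\<exists>cs vs. undirected_cycle es cs vs)"

text \<open>A transition (p, s, b, q): from state p to state q; s = True means the
  send action -b, s = False the receive action +b.\<close>
type_synonym trans = "nat \<times> bool \<times> nat \<times> nat"

text \<open>A finite state machine: (list of states K_j, initial state h_j, transitions T_j).\<close>
type_synonym fsm = "nat list \<times> nat \<times> trans list"

text \<open>A protocol: list of pairs (b, \<xi>) meaning message b belongs to M_\<xi>, and the
  list of machines F_0, ..., F_(n-1).\<close>
type_synonym protocol = "(nat \<times> nat) list \<times> fsm list"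

definition msg_of :: "protocol \<Rightarrow> nat \<Rightarrow> nat set" where
  "msg_of P \<xi> = {b. (b, \<xi>) \<in> set (fst P)}"

definition machine :: "protocol \<Rightarrow> nat \<Rightarrow> fsm" where
  "machine P j = snd P ! j"

definition states :: "protocol \<Rightarrow> nat \<Rightarrow> nat set" where
  "states P j = set (fst (machine P j))"

definition initial :: "protocol \<Rightarrow> nat \<Rightarrow> nat" where
  "initial P j = fst (snd (machine P j))"

definition transitions :: "protocol \<Rightarrow> nat \<Rightarrow> trans set" where
  "transitions P j = set (snd (snd (machine P j)))"

definition protocol_ok :: "nat \<Rightarrow> (nat \<times> nat) list \<Rightarrow> protocol \<Rightarrow> bool" where
  "protocol_ok n es P \<longleftrightarrow>
     (\<forall>(b, \<xi>) \<in> set (fst P). \<xi> < length es) \<and>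
     (\<forall>\<xi> \<xi>'. \<xi> \<noteq> \<xi>' \<longrightarrow> msg_of P \<xi> \<inter> msg_of P \<xi>' = {}) \<and>
     length (snd P) = n \<and>
     (\<forall>j < n. initial P j \<in> states P j \<and>
        (\<forall>(p, s, b, q) \<in> transitions P j. p \<in> states P j \<and> q \<in> states P j \<and>
           (\<exists>\<xi> < length es. b \<in> msg_of P \<xi> \<and>
              (if s then fst (es ! \<xi>) = j else snd (es ! \<xi>) = j))))"

definition composite_state :: "nat \<Rightarrow> protocol \<Rightarrow> nat list \<Rightarrow> bool" where
  "composite_state n P S \<longleftrightarrow> length S = n \<and> (\<forall>j < n. S ! j \<in> states P j)"

text \<open>Global states (S, C) with channel contents C = list of words, one per edge.\<close>
inductive step :: "nat \<Rightarrow> (nat \<times> nat) list \<Rightarrow> protocol \<Rightarrow>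
    nat list \<times> nat list list \<Rightarrow> nat list \<times> nat list list \<Rightarrow> bool"
  for n es P where
  step_send: "\<lbrakk> i < n; \<xi> < length es; b \<in> msg_of P \<xi>; fst (es ! \<xi>) = i;
      (S ! i, True, b, q) \<in> transitions P i \<rbrakk>
    \<Longrightarrow> step n es P (S, C) (S[i := q], C[\<xi> := C ! \<xi> @ [b]])"
| step_recv: "\<lbrakk> i < n; \<xi> < length es; b \<in> msg_of P \<xi>; snd (es ! \<xi>) = i;
      (S ! i, False, b, q) \<in> transitions P i; C ! \<xi> = b # w \<rbrakk>
    \<Longrightarrow> step n es P (S, C) (S[i := q], C[\<xi> := w])"

definition initial_global :: "nat \<Rightarrow> (nat \<times> nat) list \<Rightarrow> protocol \<Rightarrow> nat list \<times> nat list list" where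
  "initial_global n es P = (map (initial P) [0..<n], replicate (length es) [])"

definition stable_cs :: "nat \<Rightarrow> (nat \<times> nat) list \<Rightarrow> protocol \<Rightarrow> nat list \<Rightarrow> bool" where
  "stable_cs n es P S \<longleftrightarrow>
     (step n es P)\<^sup>*\<^sup>* (initial_global n es P) (S, replicate (length es) [])"

definition enc_trans :: "trans \<Rightarrow> nat" where
  "enc_trans t = (case t of (p, s, b, q) \<Rightarrow> list_encode [p, if s then 1 else 0, b, q])"

definition enc_fsm :: "fsm \<Rightarrow> nat" where
  "enc_fsm F = (case F of (Ks, h, Ts) \<Rightarrow>
      list_encode [list_encode Ks, h, list_encode (map enc_trans Ts)])"

definition enc_protocol :: "protocol \<Rightarrow> nat" where
  "enc_protocol P = list_encode [list_encode (map prod_encode (fst P)),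
                                 list_encode (map enc_fsm (snd P))]"

definition enc_instance :: "protocol \<times> nat list \<Rightarrow> nat" where
  "enc_instance x = prod_encode (enc_protocol (fst x), list_encode (snd x))"

definition instance_ok :: "nat \<Rightarrow> (nat \<times> nat) list \<Rightarrow> protocol \<times> nat list \<Rightarrow> bool" where
  "instance_ok n es x \<longleftrightarrow> protocol_ok n es (fst x) \<and> composite_state n (fst x) (snd x)"

end

theory Submission
  imports Defs
begin

text \<open>
  Suppose that a recursive function \<open>f\<close> decides stability, and let \<open>D\<close> be the partial
  recursive function that halts on \<open>e\<close> iff \<open>f\<close> rejects the instance with code
  \<open>instance_code e\<close>. That instance simulates, on input \<open>e\<close>, the automaton whose transition
  list has code \<open>e\<close>. Taking for \<open>e\<close> the code of an automaton that simulates \<open>D\<close>, the instance is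
  stable iff \<open>D\<close> halts on \<open>e\<close> iff it is not stable.

  Partial recursive functions are computed by nondeterministic counter programs, that is, by
  relations generated from increments, decrements and zero tests by composition and iteration. A
  counter program is implemented by a regular language of write and consume operations on a queue
  that holds the register contents in unary: every instruction rotates the queue once.

  On the cycle, one node runs an automaton for this language; it writes on its first cycle edge and
  consumes on its last one, whatever their orientations (so that to write may mean to receive). All
  other nodes of the cycle copy letters between their two edges, which forces the words that pass
  over all edges to be equal. Reversing the cycle if necessary, one of these two edges of the
  simulating node points forward. If both do, the copying nodes turn the channels into a queue.
  Otherwise the order of writing and consuming is not controlled, but equality of the word written
  and the word consumed already implies that the computation halts, since both words are parsed
  uniquely into blocks.
\<close>

section \<open>Partial recursive functions\<close>

inductive_simps reval_RZero_iff: "reval RZero xs z"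
inductive_simps reval_RSucc_iff: "reval RSucc xs z"
inductive_simps reval_RProj_iff: "reval (RProj i) xs z"
inductive_simps reval_RComp_iff: "reval (RComp f gs) xs z"
inductive_simps reval_RPrim_Nil_iff: "reval (RPrim f g) [] z"
inductive_simps reval_RPrim_0_iff: "reval (RPrim f g) (0 # xs) z"
inductive_simps reval_RPrim_Suc_iff: "reval (RPrim f g) (Suc n # xs) z"
inductive_simps reval_RMin_iff: "reval (RMin f) xs n"

lemma reval_deterministic: "reval f xs y \<Longrightarrow> reval f xs z \<Longrightarrow> z = y"
proof (induction arbitrary: z rule: reval.induct)
  case (reval_comp xs gs ys f y)
  from reval_comp.prems obtain zs
    where zs: "list_all2 (\<lambda>g y. reval g xs y) gs zs" "reval f zs z"
    by (auto simp: reval_RComp_iff)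
  have "zs = ys"
    using zs(1) reval_comp.IH(1)
    by (auto simp: list_all2_conv_all_nth intro!: nth_equalityI)
  then show ?case using zs(2) reval_comp.IH(2) by blast
next
  case (reval_primS f g n xs y w)
  from reval_primS.prems obtain y' where "reval (RPrim f g) (n # xs) y'" "reval g (y' # n # xs) z"
    by (auto simp: reval_RPrim_Suc_iff)
  then show ?case using reval_primS.IH by blast
next
  case (reval_min f n xs)
  from reval_min.prems have z: "reval f (z # xs) 0" "\<forall>k<z. \<exists>y. y \<noteq> 0 \<and> reval f (k # xs) y"
    by (auto simp: reval_RMin_iff)
  have "\<not> z < n" using z(1) reval_min.IH(2) by blast
  moreover have "\<not> n < z" using z(2) reval_min.IH(1) by blast
  ultimately show ?case by simp
qed (simp_all add: reval_RZero_iff reval_RSucc_iff reval_RProj_iff reval_RPrim_0_iff)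

definition computable :: "nat \<Rightarrow> (nat list \<Rightarrow> nat) \<Rightarrow> bool" where
  "computable k F \<longleftrightarrow> (\<exists>f. \<forall>xs. length xs = k \<longrightarrow> reval f xs (F xs))"

lemma computable_cong:
  "computable k F \<Longrightarrow> (\<And>xs. length xs = k \<Longrightarrow> F xs = G xs) \<Longrightarrow> computable k G"
  unfolding computable_def by metis

lemma computable_if:
  "computable k F \<Longrightarrow> computable k G \<Longrightarrow> computable k (\<lambda>xs. if b then F xs else G xs)"
  by (cases b) simp_all

lemma computable_proj: "i < k \<Longrightarrow> computable k (\<lambda>xs. xs ! i)"
  unfolding computable_def by (intro exI[of _ "RProj i"]) (auto intro: reval_proj)

lemma computable_comp:
  assumes "computable (length Gs) F" "\<And>G. G \<in> set Gs \<Longrightarrow> computable k G"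
  shows "computable k (\<lambda>xs. F (map (\<lambda>G. G xs) Gs))"
proof -
  obtain f where f: "\<And>ys. length ys = length Gs \<Longrightarrow> reval f ys (F ys)"
    using assms(1) unfolding computable_def by auto
  obtain g where g: "\<And>G xs. G \<in> set Gs \<Longrightarrow> length xs = k \<Longrightarrow> reval (g G) xs (G xs)"
    using assms(2) unfolding computable_def by metis
  have "reval (RComp f (map g Gs)) xs (F (map (\<lambda>G. G xs) Gs))" if "length xs = k" for xs
    using that by (intro reval_comp[OF _ f]) (auto simp: list_all2_conv_all_nth intro: g)
  then show ?thesis unfolding computable_def by blast
qed

lemma computable_comp1:
  assumes "computable 1 (\<lambda>xs. G (xs ! 0))" "computable k F"
  shows "computable k (\<lambda>xs. G (F xs))"
  using computable_comp[of "[F]" "\<lambda>xs. G (xs ! 0)"] assms by simp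

lemma computable_comp2:
  assumes "computable 2 (\<lambda>xs. G (xs ! 0) (xs ! 1))" "computable k F" "computable k H"
  shows "computable k (\<lambda>xs. G (F xs) (H xs))"
  using computable_comp[of "[F, H]" "\<lambda>xs. G (xs ! 0) (xs ! 1)" k] assms
  by (auto simp: numeral_2_eq_2)

lemma computable_Suc:
  assumes "computable k F"
  shows "computable k (\<lambda>xs. Suc (F xs))"
proof (rule computable_comp1[OF _ assms])
  show "computable 1 (\<lambda>xs. Suc (xs ! 0))"
    unfolding computable_def
    by (intro exI[of _ RSucc]) (auto simp: length_Suc_conv intro: reval_succ)
qed

lemma computable_const: "computable k (\<lambda>_. c)"
proof (induction c)
  case 0
  show ?case unfolding computable_def by (intro exI[of _ RZero]) (auto intro: reval_zero)
next
  case (Suc c)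
  then show ?case by (rule computable_Suc)
qed

lemma computable_primrec:
  assumes B: "computable k B" and G: "computable (Suc (Suc k)) G"
    and F0: "\<And>xs. length xs = k \<Longrightarrow> F 0 xs = B xs"
    and FS: "\<And>n xs. length xs = k \<Longrightarrow> F (Suc n) xs = G (F n xs # n # xs)"
  shows "computable (Suc k) (\<lambda>xs. F (hd xs) (tl xs))"
proof -
  obtain b where b: "\<And>xs. length xs = k \<Longrightarrow> reval b xs (B xs)"
    using B unfolding computable_def by auto
  obtain g where g: "\<And>xs. length xs = Suc (Suc k) \<Longrightarrow> reval g xs (G xs)"
    using G unfolding computable_def by auto
  have "reval (RPrim b g) (n # xs) (F n xs)" if "length xs = k" for n xs
  proof (induction n)
    case 0
    show ?case using b[OF that] F0[OF that] by (auto intro: reval_prim0)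
  next
    case (Suc n)
    have "reval g (F n xs # n # xs) (F (Suc n) xs)"
      using g[of "F n xs # n # xs"] that by (simp add: FS)
    with Suc show ?case by (rule reval_primS)
  qed
  then show ?thesis
    unfolding computable_def by (intro exI[of _ "RPrim b g"]) (auto simp: length_Suc_conv)
qed

lemma computable_iterate:
  assumes "computable k H" "computable k B"
    and G: "computable 2 (\<lambda>xs. G (xs ! 0) (xs ! 1))"
    and F: "\<And>b. F 0 b = b" "\<And>n b. F (Suc n) b = G (F n b) n"
  shows "computable k (\<lambda>xs. F (H xs) (B xs))"
proof (rule computable_comp2[OF _ assms(1,2)])
  have "computable (Suc 1) (\<lambda>xs. (\<lambda>n xs. F n (xs ! 0)) (hd xs) (tl xs))"
    by (rule computable_primrec[where B="\<lambda>xs. xs ! 0" and G="\<lambda>xs. G (xs ! 0) (xs ! 1)"])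
      (auto intro: computable_proj computable_comp2[OF G] simp: F)
  then show "computable 2 (\<lambda>xs. F (xs ! 0) (xs ! 1))"
    unfolding One_nat_def numeral_2_eq_2
    by (rule computable_cong) (auto simp: length_Suc_conv)
qed

lemma computable_add:
  assumes "computable k F" "computable k H"
  shows "computable k (\<lambda>xs. F xs + H xs)"
  using assms
proof (rule computable_iterate[where F="\<lambda>n b. n + b"])
  show "computable 2 (\<lambda>xs. Suc (xs ! 0))"
    by (intro computable_Suc computable_proj) simp
qed simp_all

lemma computable_prod_encode:
  assumes "computable k F" "computable k H"
  shows "computable k (\<lambda>xs. prod_encode (F xs, H xs))"
proof -
  have "computable k (\<lambda>xs. (\<lambda>n b. triangle n + b) (F xs + H xs) 0)"
    by (rule computable_iterate[where G="\<lambda>y n. y + Suc n"])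
      (auto intro!: computable_add computable_Suc computable_proj computable_const assms)
  then show ?thesis
    unfolding prod_encode_def using computable_add[OF _ assms(1)] by simp
qed

lemma computable_list_encode:
  assumes "\<And>j. j \<in> set js \<Longrightarrow> computable k (G j)"
  shows "computable k (\<lambda>xs. list_encode (map (\<lambda>j. G j xs) js))"
  using assms
  by (induction js) (auto intro!: computable_const computable_Suc computable_prod_encode)

lemma computable_list_encode_rev_map_upt:
  assumes "computable k H" "computable k (\<lambda>xs. list_encode (L xs))" "computable 1 (\<lambda>xs. G (xs ! 0))"
  shows "computable k (\<lambda>xs. list_encode (rev (map G [0..<H xs]) @ L xs))"
proof -
  define F where "F n b = rec_nat b (\<lambda>m y. Suc (prod_encode (G m, y))) n" for n b
  have "computable k (\<lambda>xs. F (H xs) (list_encode (L xs)))"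
    using assms(1,2)
  proof (rule computable_iterate)
    show "computable 2 (\<lambda>xs. Suc (prod_encode (G (xs ! 1), xs ! 0)))"
      by (intro computable_Suc computable_prod_encode computable_comp1[OF assms(3)] computable_proj)
        auto
  qed (auto simp: F_def)
  moreover have "F n (list_encode l) = list_encode (rev (map G [0..<n]) @ l)" for n l
    by (induction n) (auto simp: F_def)
  ultimately show ?thesis by simp
qed

lemma le_list_encode: "x \<in> set xs \<Longrightarrow> x \<le> list_encode xs"
proof (induction xs)
  case (Cons y ys)
  then show ?case
    using le_prod_encode_1[of y "list_encode ys"] le_prod_encode_2[of "list_encode ys" y] by auto
qed simp

lemma halting_iff_reval_0:
  assumes "computable 1 (\<lambda>xs. F (xs ! 0))"
  obtains g where "\<And>e. (\<exists>z. reval g [e] z) \<longleftrightarrow> reval f [F e] 0"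
proof -
  obtain t where t: "\<And>xs. length xs = 1 \<Longrightarrow> reval t xs (F (xs ! 0))"
    using assms unfolding computable_def by auto
  have "reval t [e] y \<longleftrightarrow> y = F e" for e y
    using t[of "[e]"] reval_deterministic by auto
  then have comp: "reval (RComp f [t]) [e] y \<longleftrightarrow> reval f [F e] y" for e y
    by (auto simp: reval_RComp_iff list_all2_Cons1)
  have halt_0: "(\<exists>z. reval (RMin (RProj 1)) [y] z) \<longleftrightarrow> y = 0" for y
    by (auto simp: reval_RMin_iff reval_RProj_iff)
  have "reval (RComp (RMin (RProj 1)) [RComp f [t]]) [e] z \<longleftrightarrow>
      (\<exists>y. reval f [F e] y \<and> reval (RMin (RProj 1)) [y] z)" for e z
    unfolding reval_RComp_iff[of "RMin _"] by (auto simp: list_all2_Cons1 comp)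
  then have "(\<exists>z. reval (RComp (RMin (RProj 1)) [RComp f [t]]) [e] z) \<longleftrightarrow>
      (\<exists>y. reval f [F e] y \<and> (\<exists>z. reval (RMin (RProj 1)) [y] z))" for e
    by blast
  then show ?thesis unfolding halt_0 using that by blast
qed

lemma undecidable_if_halting_instances:
  assumes computable: "computable 1 (\<lambda>xs. code (xs ! 0))"
    and inst: "\<And>g. \<exists>e x. Adm x \<and> enc x = code e \<and> (Q x \<longleftrightarrow> (\<exists>z. reval g [e] z))"
  shows "\<not> decidable_on enc Adm Q"
proof
  assume "decidable_on enc Adm Q"
  then obtain f where f: "\<And>x. Adm x \<Longrightarrow> reval f [enc x] (if Q x then 1 else 0)"
    unfolding decidable_on_def by blast
  obtain g where g: "\<And>e. (\<exists>z. reval g [e] z) \<longleftrightarrow> reval f [code e] 0"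
    using halting_iff_reval_0[OF computable, of f] by blast
  obtain e x where x: "Adm x" "enc x = code e" "Q x \<longleftrightarrow> reval f [code e] 0"
    using inst g by metis
  show False using f[OF x(1)] x(2,3) reval_deterministic by (auto split: if_splits)
qed

section \<open>Regular languages\<close>

definition deriv :: "'a list \<Rightarrow> 'a list set \<Rightarrow> 'a list set" where
  "deriv u L = {v. u @ v \<in> L}"

abbreviation derivs :: "'a list set \<Rightarrow> 'a list set set" where
  "derivs L \<equiv> range (\<lambda>u. deriv u L)"

definition regular :: "'a list set \<Rightarrow> bool" where
  "regular L \<longleftrightarrow> finite (derivs L)"

definition conc :: "'a list set \<Rightarrow> 'a list set \<Rightarrow> 'a list set" (infixr "\<cdot>" 75) where
  "A \<cdot> B = {u @ v |u v. u \<in> A \<and> v \<in> B}"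

inductive_set star :: "'a list set \<Rightarrow> 'a list set" for A where
  star_Nil: "[] \<in> star A"
| star_append: "u \<in> A \<Longrightarrow> v \<in> star A \<Longrightarrow> u @ v \<in> star A"

lemma concI: "u \<in> A \<Longrightarrow> v \<in> B \<Longrightarrow> u @ v \<in> A \<cdot> B"
  by (auto simp: conc_def)

lemma concE:
  assumes "w \<in> A \<cdot> B" obtains u v where "w = u @ v" "u \<in> A" "v \<in> B"
  using assms by (auto simp: conc_def)

lemma deriv_Nil [simp]: "deriv [] L = L"
  by (simp add: deriv_def)

lemma deriv_append: "deriv (u @ v) L = deriv v (deriv u L)"
  by (simp add: deriv_def)

lemma deriv_letter_conc:
  "deriv [a] (A \<cdot> B) = deriv [a] A \<cdot> B \<union> (if [] \<in> A then deriv [a] B else {})"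
  by (auto simp: deriv_def conc_def Cons_eq_append_conv)

lemma deriv_letter_star: "deriv [a] (star A) = deriv [a] A \<cdot> star A"
proof -
  have "\<exists>v v'. w = v @ v' \<and> a # v \<in> A \<and> v' \<in> star A" if "a # w \<in> star A" for w
    using that by (induction "a # w" rule: star.induct) (auto simp: append_eq_Cons_conv)
  then show ?thesis by (auto simp: deriv_def conc_def dest: star_append[of "a # _" A])
qed

lemma self_in_derivs: "L \<in> derivs L"
  by (rule range_eqI[of _ _ "[]"]) simp

lemma deriv_in_derivs: "X \<in> derivs L \<Longrightarrow> deriv u X \<in> derivs L"
  by (auto simp flip: deriv_append)

lemma regularI:
  assumes "finite D" "L \<in> D" "\<And>a X. X \<in> D \<Longrightarrow> deriv [a] X \<in> D"
  shows "regular L"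
proof -
  have "deriv u L \<in> D" for u
  proof (induction u rule: rev_induct)
    case (snoc a u)
    then show ?case by (simp add: deriv_append assms(3))
  qed (simp add: assms(2))
  then show ?thesis unfolding regular_def using assms(1) by (meson finite_subset image_subset_iff)
qed

lemma regular_empty: "regular {}"
  by (rule regularI[of "{{}}"]) (auto simp: deriv_def)

lemma regular_Nil: "regular {[]}"
  by (rule regularI[of "{{}, {[]}}"]) (auto simp: deriv_def)

lemma regular_letter: "regular {[a]}"
  by (rule regularI[of "{{}, {[]}, {[a]}}"]) (auto simp: deriv_def)

lemma regular_conc:
  assumes "regular A" "regular B"
  shows "regular (A \<cdot> B)"
proof (rule regularI)
  let ?D = "(\<lambda>(X, Y). X \<cdot> B \<union> \<Union> Y) ` (derivs A \<times> Pow (derivs B))"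
  show "finite ?D" using assms by (auto simp: regular_def)
  show "A \<cdot> B \<in> ?D"
    by (rule image_eqI[where x="(A, {})"]) (auto intro: self_in_derivs)
  fix a Z assume "Z \<in> ?D"
  then obtain X Y where Z: "Z = X \<cdot> B \<union> \<Union> Y" and X: "X \<in> derivs A" and Y: "Y \<subseteq> derivs B"
    by auto
  let ?Y = "deriv [a] ` Y \<union> (if [] \<in> X then {deriv [a] B} else {})"
  have "deriv [a] Z = deriv [a] (X \<cdot> B) \<union> \<Union> (deriv [a] ` Y)"
    unfolding Z by (auto simp: deriv_def)
  then have "deriv [a] Z = deriv [a] X \<cdot> B \<union> \<Union> ?Y"
    unfolding deriv_letter_conc by auto
  moreover have "?Y \<subseteq> derivs B" using Y by (auto intro: deriv_in_derivs)
  ultimately show "deriv [a] Z \<in> ?D"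
    using deriv_in_derivs[OF X] by (intro image_eqI[where x="(deriv [a] X, ?Y)"]) auto
qed

lemma regular_star:
  assumes "regular A"
  shows "regular (star A)"
proof (rule regularI)
  let ?D = "insert (star A) ((\<lambda>Y. \<Union> Y \<cdot> star A) ` Pow (derivs A))"
  show "finite ?D" using assms by (auto simp: regular_def)
  show "star A \<in> ?D" by simp
  fix a Z assume "Z \<in> ?D"
  then consider (star) "Z = star A" | (conc) Y where "Z = \<Union> Y \<cdot> star A" "Y \<subseteq> derivs A" by blast
  then obtain Y where Y: "Y \<subseteq> derivs A" and Z: "deriv [a] Z = \<Union> Y \<cdot> star A"
  proof cases
    case star
    then show ?thesis using that[of "{deriv [a] A}"] by (simp add: deriv_letter_star)
  next
    case conc
    let ?Y = "deriv [a] ` Y \<union> (if [] \<in> \<Union> Y then {deriv [a] A} else {})"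
    have "deriv [a] Z = \<Union> ?Y \<cdot> star A"
      unfolding conc(1) deriv_letter_conc deriv_letter_star by (auto simp: conc_def deriv_def)
    moreover have "?Y \<subseteq> derivs A" using conc(2) by (auto intro: deriv_in_derivs)
    ultimately show ?thesis using that by blast
  qed
  then show "deriv [a] Z \<in> ?D" by blast
qed

lemma regular_word: "regular {u}"
proof (induction u)
  case (Cons a u)
  have "{a # u} = {[a]} \<cdot> {u}" by (auto simp: conc_def)
  then show ?case using Cons by (simp add: regular_conc regular_letter)
qed (rule regular_Nil)

section \<open>Automata\<close>

inductive path :: "('s \<times> 'a \<times> 's) set \<Rightarrow> 's \<Rightarrow> 'a list \<Rightarrow> 's \<Rightarrow> bool" for T where
  path_Nil: "path T p [] p"
| path_Cons: "(p, a, q) \<in> T \<Longrightarrow> path T q w r \<Longrightarrow> path T p (a # w) r"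

inductive_simps path_Nil_iff: "path T p [] r"
inductive_simps path_Cons_iff: "path T p (a # w) r"

lemma path_snoc: "path T p u q \<Longrightarrow> (q, a, r) \<in> T \<Longrightarrow> path T p (u @ [a]) r"
  by (induction rule: path.induct) (auto intro: path.intros)

lemma path_mono: "path T p w q \<Longrightarrow> T \<subseteq> T' \<Longrightarrow> path T' p w q"
  by (induction rule: path.induct) (auto intro: path.intros)

lemma path_map_labels:
  "path ((\<lambda>(p, a, q). (p, f a, q)) ` T) p v r \<Longrightarrow> \<exists>w. v = map f w \<and> path T p w r"
proof (induction rule: path.induct)
  case (path_Cons p b q v r)
  then obtain a w where "(p, a, q) \<in> T" "b = f a" "v = map f w" "path T q w r" by auto
  then show ?case by (intro exI[of _ "a # w"]) (auto intro: path.path_Cons)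
qed (auto intro: path_Nil)

lemma path_deriv_automaton:
  fixes L :: "'a list set"
  assumes inj: "inj_on c (derivs L)" and fresh: "f \<notin> c ` derivs L"
    and T: "T = {(c X, a, q) |X a q. X \<in> derivs L \<and> (q = c (deriv [a] X) \<or> q = f \<and> [a] \<in> X)}"
    and "X \<in> derivs L"
  shows "path T (c X) w f \<longleftrightarrow> w \<in> X \<and> w \<noteq> []"
  using assms(4)
proof (induction w arbitrary: X)
  case Nil
  then show ?case using fresh by (auto simp: path_Nil_iff)
next
  case (Cons a w)
  have "(c X, a, q) \<in> T \<longleftrightarrow> q = c (deriv [a] X) \<or> q = f \<and> [a] \<in> X" for q
    using Cons.prems inj_onD[OF inj _ Cons.prems] by (auto simp: T)
  then have "path T (c X) (a # w) f \<longleftrightarrow>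
      path T (c (deriv [a] X)) w f \<or> ([a] \<in> X \<and> path T f w f)"
    by (auto simp: path_Cons_iff)
  also have "path T f w f \<longleftrightarrow> w = []"
    using fresh by (cases w) (auto simp: T path_Nil_iff path_Cons_iff)
  also have "path T (c (deriv [a] X)) w f \<longleftrightarrow> a # w \<in> X \<and> w \<noteq> []"
    unfolding Cons.IH[OF deriv_in_derivs[OF Cons.prems, of "[a]"]] by (simp add: deriv_def)
  finally show ?case by auto
qed

lemma regular_automaton:
  fixes L :: "'a::finite list set" and K :: "'s set"
  assumes reg: "regular L" and ne: "[] \<notin> L"
    and K: "infinite K" "i \<in> K" "f \<in> K" "i \<noteq> f"
  obtains T where "finite T" "T \<subseteq> K \<times> UNIV \<times> K" "\<And>w. path T i w f \<longleftrightarrow> w \<in> L"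
proof -
  have fin: "finite (derivs L)" using reg by (simp add: regular_def)
  obtain n :: "'a list set \<Rightarrow> nat" where n: "inj_on n (derivs L)"
    using finite_imp_inj_to_nat_seg[OF fin] by blast
  obtain h :: "nat \<Rightarrow> 's" where h: "inj h" "range h \<subseteq> K - {i, f}"
    using infinite_countable_subset[of "K - {i, f}"] K(1) by auto
  define c where "c X = (if X = L then i else h (n X))" for X
  have h_iff: "h x = h y \<longleftrightarrow> x = y" "h x \<in> K" "h x \<noteq> i" "h x \<noteq> f" for x y
    using h by (auto simp: inj_eq)
  have c_inj: "inj_on c (derivs L)"
    using h_iff inj_onD[OF n] by (intro inj_onI) (auto simp: c_def split: if_splits)
  have c_range: "c ` derivs L \<subseteq> K - {f}"
    using h_iff(2-4) K by (auto simp: c_def)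
  define T where
    "T = {(c X, a, q) |X a q. X \<in> derivs L \<and> (q = c (deriv [a] X) \<or> q = f \<and> [a] \<in> X)}"
  have T_sub: "T \<subseteq> c ` derivs L \<times> UNIV \<times> insert f (c ` derivs L)"
    by (auto simp: T_def intro: deriv_in_derivs)
  show ?thesis
  proof (rule that)
    show "finite T" using T_sub by (rule finite_subset) (use fin in simp)
    show "T \<subseteq> K \<times> UNIV \<times> K" using T_sub c_range K(3) by blast
    have "c L = i" by (simp add: c_def)
    moreover have "f \<notin> c ` derivs L" using c_range by blast
    ultimately show "path T i w f \<longleftrightarrow> w \<in> L" for w
      using path_deriv_automaton[OF c_inj _ T_def self_in_derivs, of w] ne by auto
  qed
qed

section \<open>Queue operations\<close>

definition written :: "(bool \<times> 'b) list \<Rightarrow> 'b list" where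
  "written w = map snd (filter fst w)"

definition consumed :: "(bool \<times> 'b) list \<Rightarrow> 'b list" where
  "consumed w = map snd (filter (Not \<circ> fst) w)"

lemma written_simps [simp]:
  "written [] = []" "written ((True, b) # w) = b # written w" "written ((False, b) # w) = written w"
  "written (u @ v) = written u @ written v"
  by (auto simp: written_def)

lemma consumed_simps [simp]:
  "consumed [] = []" "consumed ((True, b) # w) = consumed w"
  "consumed ((False, b) # w) = b # consumed w"
  "consumed (u @ v) = consumed u @ consumed v"
  by (auto simp: consumed_def)

lemma written_map_Pair [simp]: "written (map (Pair s) u) = (if s then u else [])"
  by (induction u) auto

lemma consumed_map_Pair [simp]: "consumed (map (Pair s) u) = (if s then [] else u)"
  by (induction u) auto

inductive qrun :: "'b list \<Rightarrow> (bool \<times> 'b) list \<Rightarrow> 'b list \<Rightarrow> bool" where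
  qrun_Nil: "qrun q [] q"
| qrun_write: "qrun (q @ [b]) w q' \<Longrightarrow> qrun q ((True, b) # w) q'"
| qrun_consume: "qrun q w q' \<Longrightarrow> qrun (b # q) ((False, b) # w) q'"

lemma qrun_append: "qrun q u q' \<Longrightarrow> qrun q' v q'' \<Longrightarrow> qrun q (u @ v) q''"
  by (induction rule: qrun.induct) (auto intro: qrun.intros)

lemma qrun_written_consumed: "qrun q w q' \<Longrightarrow> q @ written w = consumed w @ q'"
  by (induction rule: qrun.induct) auto

lemma qrun_write_all: "qrun q (map (Pair True) u) (q @ u)"
proof (induction u arbitrary: q)
  case (Cons b u)
  show ?case using Cons[of "q @ [b]"] by (auto intro: qrun_write)
qed (simp add: qrun_Nil)

lemma qrun_consume_all: "qrun u (map (Pair False) u) []"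
  by (induction u) (auto intro: qrun.intros)

section \<open>Rotating a queue of numbers\<close>

definition block :: "nat \<Rightarrow> bool list" where
  "block x = replicate x False @ [True]"

definition blocks :: "nat list \<Rightarrow> bool list" where
  "blocks xs = concat (map block xs)"

lemma block_simps [simp]: "block 0 = [True]" "block (Suc x) = False # block x"
  by (auto simp: block_def)

lemma block_neq_Nil [simp]: "block x \<noteq> []"
  by (simp add: block_def)

lemma blocks_simps [simp]:
  "blocks [] = []" "blocks (x # xs) = block x @ blocks xs" "blocks (xs @ ys) = blocks xs @ blocks ys"
  by (auto simp: blocks_def)

lemma block_append_eq_iff: "block x @ u = block y @ v \<longleftrightarrow> x = y \<and> u = v"
proof (induction x arbitrary: y)
  case 0
  show ?case by (cases y) auto
next
  case (Suc x)
  then show ?case by (cases y) auto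
qed

lemma blocks_inject: "blocks xs = blocks ys \<longleftrightarrow> xs = ys"
proof (induction xs arbitrary: ys)
  case Nil
  show ?case by (cases ys) auto
next
  case (Cons x xs)
  then show ?case by (cases ys) (auto simp: block_append_eq_iff)
qed

definition rotates :: "(nat list \<times> nat list) set \<Rightarrow> (bool \<times> bool) list set \<Rightarrow> bool" where
  "rotates \<beta> A \<longleftrightarrow> regular A \<and>
     (\<forall>(us, vs) \<in> \<beta>. \<exists>w \<in> A. \<forall>q. qrun (blocks us @ q) w (q @ blocks vs)) \<and>
     (\<forall>w \<in> A. \<exists>(us, vs) \<in> \<beta>. consumed w = blocks us \<and> written w = blocks vs)"

lemma rotates_regular: "rotates \<beta> A \<Longrightarrow> regular A"
  by (simp add: rotates_def)

lemma rotates_complete: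
  assumes "rotates \<beta> A" "(us, vs) \<in> \<beta>"
  obtains w where "w \<in> A" "\<And>q. qrun (blocks us @ q) w (q @ blocks vs)"
  using assms unfolding rotates_def by blast

lemma rotates_sound:
  assumes "rotates \<beta> A" "w \<in> A"
  obtains us vs where "(us, vs) \<in> \<beta>" "consumed w = blocks us" "written w = blocks vs"
  using assms unfolding rotates_def by blast

lemma rotates_Nil: "rotates {([], [])} {[]}"
  by (auto simp: rotates_def regular_Nil qrun_Nil)

lemma rotates_conc:
  assumes A: "rotates \<beta> A" and B: "rotates \<gamma> B"
  shows "rotates {(us @ us', vs @ vs') |us vs us' vs'. (us, vs) \<in> \<beta> \<and> (us', vs') \<in> \<gamma>} (A \<cdot> B)"
  unfolding rotates_def
proof (intro conjI ballI, goal_cases regular complete sound)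
  case regular
  show ?case using rotates_regular[OF A] rotates_regular[OF B] by (rule regular_conc)
next
  case (complete p)
  then obtain us vs us' vs' where p: "p = (us @ us', vs @ vs')" "(us, vs) \<in> \<beta>" "(us', vs') \<in> \<gamma>"
    by blast
  obtain u where u: "u \<in> A" "\<And>q. qrun (blocks us @ q) u (q @ blocks vs)"
    using rotates_complete[OF A p(2)] by blast
  obtain v where v: "v \<in> B" "\<And>q. qrun (blocks us' @ q) v (q @ blocks vs')"
    using rotates_complete[OF B p(3)] by blast
  have "qrun (blocks (us @ us') @ q) (u @ v) (q @ blocks (vs @ vs'))" for q
    using qrun_append[OF u(2)[of "blocks us' @ q"] v(2)[of "q @ blocks vs", folded append.assoc]]
    by simp
  then show ?case using p(1) concI[OF u(1) v(1)] by auto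
next
  case (sound w)
  then obtain u v where w: "w = u @ v" "u \<in> A" "v \<in> B" by (rule concE)
  obtain us vs where "(us, vs) \<in> \<beta>" "consumed u = blocks us" "written u = blocks vs"
    using rotates_sound[OF A w(2)] by blast
  moreover obtain us' vs' where "(us', vs') \<in> \<gamma>" "consumed v = blocks us'" "written v = blocks vs'"
    using rotates_sound[OF B w(3)] by blast
  ultimately show ?case
    using w(1) by (intro bexI[of _ "(us @ us', vs @ vs')"]) auto
qed

abbreviation regs :: "nat \<Rightarrow> (nat \<Rightarrow> nat) \<Rightarrow> nat list" where
  "regs k \<nu> \<equiv> map \<nu> [0..<k]"

definition rotates_block :: "(nat \<times> nat) set \<Rightarrow> (bool \<times> bool) list set \<Rightarrow> bool" where
  "rotates_block \<beta> A \<longleftrightarrow> rotates {([x], [y]) |x y. (x, y) \<in> \<beta>} A"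

lemma rotates_pointwise:
  assumes "\<And>j. j < k \<Longrightarrow> rotates_block (\<beta> j) (A j)"
  shows "\<exists>B. rotates {(regs k \<nu>, regs k \<nu>') |\<nu> \<nu>'. \<forall>j<k. (\<nu> j, \<nu>' j) \<in> \<beta> j} B"
  using assms
proof (induction k)
  case 0
  show ?case using rotates_Nil by auto
next
  case (Suc k)
  let ?R = "\<lambda>k. {(regs k \<nu>, regs k \<nu>') |\<nu> \<nu>'. \<forall>j<k. (\<nu> j, \<nu>' j) \<in> \<beta> j}"
  obtain B where "rotates (?R k) B" using Suc by auto
  moreover have "rotates {([x], [y]) |x y. (x, y) \<in> \<beta> k} (A k)"
    using Suc.prems[of k] by (simp add: rotates_block_def)
  ultimately have "rotates {(us @ us', vs @ vs') |us vs us' vs'.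
      (us, vs) \<in> ?R k \<and> (us', vs') \<in> {([x], [y]) |x y. (x, y) \<in> \<beta> k}} (B \<cdot> A k)" (is "rotates ?L _")
    by (rule rotates_conc)
  moreover have "?L = ?R (Suc k)"
  proof (intro equalityI subsetI)
    fix p assume "p \<in> ?L"
    then obtain \<nu> \<nu>' x y where p: "p = (regs k \<nu> @ [x], regs k \<nu>' @ [y])"
      "\<forall>j<k. (\<nu> j, \<nu>' j) \<in> \<beta> j" "(x, y) \<in> \<beta> k"
      by blast
    then have "p = (regs (Suc k) (\<nu>(k := x)), regs (Suc k) (\<nu>'(k := y)))"
      "\<forall>j<Suc k. ((\<nu>(k := x)) j, (\<nu>'(k := y)) j) \<in> \<beta> j"
      by (auto simp: less_Suc_eq)
    then show "p \<in> ?R (Suc k)" by blast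
  next
    fix p assume "p \<in> ?R (Suc k)"
    then obtain \<nu> \<nu>' where "p = (regs k \<nu> @ [\<nu> k], regs k \<nu>' @ [\<nu>' k])"
      "\<forall>j<k. (\<nu> j, \<nu>' j) \<in> \<beta> j" "(\<nu> k, \<nu>' k) \<in> \<beta> k"
      by (auto simp: less_Suc_eq)
    then show "p \<in> ?L" by blast
  qed
  ultimately show ?case by metis
qed

lemma rotates_blockI:
  assumes "regular (range w)" "\<beta> = {(f x, g x) |x. True}"
    and "\<And>x. consumed (w x) = block (f x)" "\<And>x. written (w x) = block (g x)"
    and "\<And>x q. qrun (block (f x) @ q) (w x) (q @ block (g x))"
  shows "rotates_block \<beta> (range w)"
  using assms unfolding rotates_block_def rotates_def by fastforce

definition copy_word :: "nat \<Rightarrow> (bool \<times> bool) list" where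
  "copy_word x = concat (replicate x [(False, False), (True, False)]) @ [(False, True), (True, True)]"

lemma star_word: "star {u} = range (\<lambda>x. concat (replicate x u))"
proof (intro equalityI subsetI)
  fix v assume "v \<in> star {u}"
  then show "v \<in> range (\<lambda>x. concat (replicate x u))"
  proof (induction rule: star.induct)
    case star_Nil
    show ?case by (rule range_eqI[of _ _ 0]) simp
  next
    case (star_append u' v)
    then obtain x where "v = concat (replicate x u)" by blast
    with star_append show ?case by (intro range_eqI[of _ _ "Suc x"]) simp
  qed
next
  have "concat (replicate x u) \<in> star {u}" for x
    by (induction x) (auto intro: star.intros)
  then show "v \<in> star {u}" if "v \<in> range (\<lambda>x. concat (replicate x u))" for v using that by blast
qed

lemma regular_copy_words: "regular (range copy_word)"
proof -
  have "range copy_word = star {[(False, False), (True, False)]} \<cdot> {[(False, True), (True, True)]}"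
    by (auto simp: star_word conc_def copy_word_def)
  then show ?thesis by (simp add: regular_conc regular_star regular_word)
qed

lemma consumed_copy_word: "consumed (copy_word x) = block x"
  and written_copy_word: "written (copy_word x) = block x"
  unfolding copy_word_def by (induction x) auto

lemma qrun_copy_word: "qrun (block x @ q) (copy_word x) (q @ block x)"
proof (induction x arbitrary: q)
  case 0
  show ?case by (auto simp: copy_word_def intro!: qrun.intros)
next
  case (Suc x)
  then show ?case using Suc[of "q @ [False]"] by (auto simp: copy_word_def intro!: qrun.intros)
qed

lemmas copy_word_simps = consumed_copy_word written_copy_word qrun_copy_word

lemma rotates_block_copy: "rotates_block Id (range copy_word)"
  by (rule rotates_blockI[where f="\<lambda>x. x" and g="\<lambda>x. x"])
    (auto simp: copy_word_simps regular_copy_words)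

lemma regular_Cons_copy_words: "regular (range (\<lambda>x. a # copy_word x))"
proof -
  have "range (\<lambda>x. a # copy_word x) = {[a]} \<cdot> range copy_word" by (auto simp: conc_def)
  then show ?thesis by (simp add: regular_conc regular_letter regular_copy_words)
qed

lemma rotates_block_inc:
  "rotates_block {(x, Suc x) |x. True} (range (\<lambda>x. (True, False) # copy_word x))"
proof (rule rotates_blockI[where f="\<lambda>x. x" and g=Suc])
  show "qrun (block x @ q) ((True, False) # copy_word x) (q @ block (Suc x))" for x q
    using qrun_copy_word[of x "q @ [False]"] by (auto intro: qrun_write)
qed (auto simp: copy_word_simps regular_Cons_copy_words)

lemma rotates_block_dec:
  "rotates_block {(Suc x, x) |x. True} (range (\<lambda>x. (False, False) # copy_word x))"
  by (rule rotates_blockI[where f=Suc and g="\<lambda>x. x"])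
    (auto simp: copy_word_simps regular_Cons_copy_words intro: qrun_consume)

lemma rotates_block_zero: "rotates_block {(0, 0)} {[(False, True), (True, True)]}"
  using rotates_blockI[where w="\<lambda>_ :: unit. [(False, True), (True, True)]"
      and f="\<lambda>_. 0" and g="\<lambda>_. 0"]
  by (auto simp: regular_word intro!: qrun.intros)

section \<open>Queue implementations of register programs\<close>

lemma ex_registers:
  assumes "length ys = r"
  obtains \<nu>' where "regs r \<nu>' = ys" "\<And>j. r \<le> j \<Longrightarrow> \<nu>' j = \<nu> j"
proof
  let ?\<nu>' = "\<lambda>j. if j < r then ys ! j else \<nu> j"
  show "regs r ?\<nu>' = ys" using assms by (auto intro: nth_equalityI)
qed simp

text \<open>Soundness is stated without reference to queue runs: if the simulating node sends on both its
  cycle edges, or receives on both, consumption may overtake writing, and only the two projections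
  are known to agree.\<close>

definition transforms :: "nat \<Rightarrow> (nat \<Rightarrow> nat) rel \<Rightarrow> (bool \<times> bool) list \<Rightarrow> bool" where
  "transforms r \<rho> w \<longleftrightarrow> (\<exists>us vs. length us = length vs \<and>
     consumed w = blocks us \<and> written w = blocks vs \<and>
     (\<forall>\<nu> \<nu>'. regs r \<nu> @ vs = us @ regs r \<nu>' \<longrightarrow> (\<forall>j\<ge>r. \<nu>' j = \<nu> j) \<longrightarrow> (\<nu>, \<nu>') \<in> \<rho>))"

lemma transformsE:
  assumes "transforms r \<rho> w"
  obtains us vs where "length us = length vs" "consumed w = blocks us" "written w = blocks vs"
    "\<And>\<nu> \<nu>'. regs r \<nu> @ vs = us @ regs r \<nu>' \<Longrightarrow> (\<And>j. r \<le> j \<Longrightarrow> \<nu>' j = \<nu> j) \<Longrightarrow> (\<nu>, \<nu>') \<in> \<rho>"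
  using assms unfolding transforms_def by blast

lemma transforms_mono: "transforms r \<rho> w \<Longrightarrow> \<rho> \<subseteq> \<sigma> \<Longrightarrow> transforms r \<sigma> w"
  unfolding transforms_def by blast

lemma transforms_Nil: "transforms r Id []"
proof -
  have "\<nu> = \<nu>'" if "\<forall>j<r. \<nu> j = \<nu>' j" "\<forall>j\<ge>r. \<nu>' j = \<nu> j" for \<nu> \<nu>' :: "nat \<Rightarrow> nat"
    using that by (metis ext not_le)
  then show ?thesis unfolding transforms_def by (intro exI[of _ "[]"]) auto
qed

lemma transforms_append:
  assumes "transforms r \<rho> u" "transforms r \<sigma> v"
  shows "transforms r (\<rho> O \<sigma>) (u @ v)"
proof -
  obtain us vs where u: "length us = length vs" "consumed u = blocks us" "written u = blocks vs"
    "\<And>\<nu> \<nu>'. regs r \<nu> @ vs = us @ regs r \<nu>' \<Longrightarrow> (\<And>j. r \<le> j \<Longrightarrow> \<nu>' j = \<nu> j) \<Longrightarrow> (\<nu>, \<nu>') \<in> \<rho>"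
    using transformsE[OF assms(1)] by blast
  obtain us' vs' where v: "length us' = length vs'" "consumed v = blocks us'" "written v = blocks vs'"
    "\<And>\<nu> \<nu>'. regs r \<nu> @ vs' = us' @ regs r \<nu>' \<Longrightarrow> (\<And>j. r \<le> j \<Longrightarrow> \<nu>' j = \<nu> j) \<Longrightarrow> (\<nu>, \<nu>') \<in> \<sigma>"
    using transformsE[OF assms(2)] by blast
  have "(\<nu>, \<nu>'') \<in> \<rho> O \<sigma>"
    if eq: "regs r \<nu> @ vs @ vs' = us @ us' @ regs r \<nu>''" and rest: "\<forall>j\<ge>r. \<nu>'' j = \<nu> j"
    for \<nu> \<nu>''
  proof -
    obtain ys where ys: "regs r \<nu> @ vs = us @ ys" "ys @ vs' = us' @ regs r \<nu>''"
      using eq u(1) append_eq_append_conv2[of "regs r \<nu> @ vs" vs' us "us' @ regs r \<nu>''"]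
      by auto
    have "length ys = r" using arg_cong[OF ys(1), of length] u(1) by simp
    then obtain \<nu>' where \<nu>': "regs r \<nu>' = ys" "\<And>j. r \<le> j \<Longrightarrow> \<nu>' j = \<nu> j"
      using ex_registers[of ys r \<nu>] by blast
    have "(\<nu>, \<nu>') \<in> \<rho>" using u(4) ys(1) \<nu>' by metis
    moreover have "(\<nu>', \<nu>'') \<in> \<sigma>" using v(4) ys(2) \<nu>' rest by metis
    ultimately show ?thesis by blast
  qed
  then show ?thesis
    unfolding transforms_def using u v by (intro exI[of _ "us @ us'"] exI[of _ "vs @ vs'"]) auto
qed

definition queue_impl :: "nat \<Rightarrow> (nat \<Rightarrow> nat) rel \<Rightarrow> (bool \<times> bool) list set \<Rightarrow> bool" where
  "queue_impl r \<rho> A \<longleftrightarrow> regular A \<and>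
     (\<forall>(\<nu>, \<nu>') \<in> \<rho>. \<exists>w \<in> A. qrun (blocks (regs r \<nu>)) w (blocks (regs r \<nu>'))) \<and>
     (\<forall>w \<in> A. transforms r \<rho> w)"

lemma queue_impl_complete:
  assumes "queue_impl r \<rho> A" "(\<nu>, \<nu>') \<in> \<rho>"
  obtains w where "w \<in> A" "qrun (blocks (regs r \<nu>)) w (blocks (regs r \<nu>'))"
  using assms unfolding queue_impl_def by blast

lemma queue_impl_empty: "queue_impl r {} {}"
  unfolding queue_impl_def by (auto intro: regular_empty)

lemma queue_impl_Id: "queue_impl r Id {[]}"
  unfolding queue_impl_def by (auto intro: regular_Nil qrun_Nil transforms_Nil)

lemma queue_impl_relcomp:
  assumes A: "queue_impl r \<rho> A" and B: "queue_impl r \<sigma> B"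
  shows "queue_impl r (\<rho> O \<sigma>) (A \<cdot> B)"
  unfolding queue_impl_def
proof (intro conjI ballI, goal_cases regular complete sound)
  case regular
  show ?case using A B by (auto simp: queue_impl_def intro: regular_conc)
next
  case (complete p)
  then obtain \<nu> \<nu>' \<nu>'' where p: "p = (\<nu>, \<nu>'')" "(\<nu>, \<nu>') \<in> \<rho>" "(\<nu>', \<nu>'') \<in> \<sigma>" by blast
  obtain u where u: "u \<in> A" "qrun (blocks (regs r \<nu>)) u (blocks (regs r \<nu>'))"
    using queue_impl_complete[OF A p(2)] by blast
  obtain v where v: "v \<in> B" "qrun (blocks (regs r \<nu>')) v (blocks (regs r \<nu>''))"
    using queue_impl_complete[OF B p(3)] by blast
  show ?case
    unfolding p(1) using concI[OF u(1) v(1)] qrun_append[OF u(2) v(2)] by blast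
next
  case (sound w)
  then show ?case using A B by (auto simp: queue_impl_def elim!: concE intro: transforms_append)
qed

lemma queue_impl_rtrancl:
  assumes A: "queue_impl r \<rho> A"
  shows "queue_impl r (\<rho>\<^sup>*) (star A)"
  unfolding queue_impl_def
proof (intro conjI ballI, goal_cases regular complete sound)
  case regular
  show ?case using A by (auto simp: queue_impl_def intro: regular_star)
next
  case (complete p)
  have "\<exists>w \<in> star A. qrun (blocks (regs r \<nu>)) w (blocks (regs r \<nu>'))"
    if "(\<nu>, \<nu>') \<in> \<rho>\<^sup>*" for \<nu> \<nu>'
    using that
  proof (induction rule: converse_rtrancl_induct)
    case base
    show ?case by (auto intro: star_Nil qrun_Nil)
  next
    case (step \<nu>1 \<nu>2)
    obtain u where "u \<in> A" "qrun (blocks (regs r \<nu>1)) u (blocks (regs r \<nu>2))"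
      using queue_impl_complete[OF A step(1)] by blast
    with step(3) show ?case by (auto intro: star_append qrun_append)
  qed
  with complete show ?case by auto
next
  case (sound w)
  then show ?case
  proof (induction rule: star.induct)
    case star_Nil
    show ?case by (rule transforms_mono[OF transforms_Nil]) auto
  next
    case (star_append u v)
    have "transforms r (\<rho> O \<rho>\<^sup>*) (u @ v)"
      using A star_append by (auto simp: queue_impl_def intro: transforms_append)
    then show ?case by (rule transforms_mono) (auto intro: converse_rtrancl_into_rtrancl)
  qed
qed

lemma queue_impl_pointwise:
  assumes "\<And>j. j < r \<Longrightarrow> rotates_block (\<beta> j) (A j)"
  shows "\<exists>B. queue_impl r {(\<nu>, \<nu>'). (\<forall>j<r. (\<nu> j, \<nu>' j) \<in> \<beta> j) \<and> (\<forall>j\<ge>r. \<nu>' j = \<nu> j)} B"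
    (is "\<exists>B. queue_impl r ?\<rho> B")
proof -
  obtain B where
    B: "rotates {(regs r \<nu>, regs r \<nu>') |\<nu> \<nu>'. \<forall>j<r. (\<nu> j, \<nu>' j) \<in> \<beta> j} B" (is "rotates ?R B")
    using rotates_pointwise[of r \<beta> A] assms by blast
  have "\<exists>w \<in> B. qrun (blocks (regs r \<nu>)) w (blocks (regs r \<nu>'))"
    if "\<forall>j<r. (\<nu> j, \<nu>' j) \<in> \<beta> j" for \<nu> \<nu>'
  proof -
    have "(regs r \<nu>, regs r \<nu>') \<in> ?R" using that by blast
    from rotates_complete[OF B this] show ?thesis by (metis append_Nil append_Nil2)
  qed
  moreover have "transforms r ?\<rho> w" if in_B: "w \<in> B" for w
  proof -
    obtain \<mu> \<mu>' where w: "\<forall>j<r. (\<mu> j, \<mu>' j) \<in> \<beta> j"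
      "consumed w = blocks (regs r \<mu>)" "written w = blocks (regs r \<mu>')"
      using rotates_sound[OF B in_B] by blast
    have "(\<nu>, \<nu>') \<in> ?\<rho>"
      if "regs r \<nu> @ regs r \<mu>' = regs r \<mu> @ regs r \<nu>'" "\<forall>j\<ge>r. \<nu>' j = \<nu> j" for \<nu> \<nu>'
      using w(1) that by (auto simp: append_eq_append_conv)
    then show ?thesis
      unfolding transforms_def using w(2,3) by (intro exI[of _ "regs _ _"]) auto
  qed
  ultimately show ?thesis
    using rotates_regular[OF B] unfolding queue_impl_def by (intro exI[of _ B]) auto
qed

definition on_register :: "nat \<Rightarrow> (nat \<times> nat) set \<Rightarrow> (nat \<Rightarrow> nat) rel" where
  "on_register i \<beta> = {(\<nu>, \<nu>(i := y)) |\<nu> y. (\<nu> i, y) \<in> \<beta>}"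

lemma queue_impl_on_register:
  assumes "i < r" "rotates_block \<beta> A"
  shows "\<exists>B. queue_impl r (on_register i \<beta>) B"
proof -
  have "on_register i \<beta> =
    {(\<nu>, \<nu>'). (\<forall>j<r. (\<nu> j, \<nu>' j) \<in> (if j = i then \<beta> else Id)) \<and> (\<forall>j\<ge>r. \<nu>' j = \<nu> j)}" (is "?L = ?R")
  proof (intro equalityI subsetI)
    fix p assume "p \<in> ?R"
    then obtain \<nu> \<nu>' where p: "p = (\<nu>, \<nu>')"
      "\<And>j. j < r \<Longrightarrow> (\<nu> j, \<nu>' j) \<in> (if j = i then \<beta> else Id)" "\<And>j. j \<ge> r \<Longrightarrow> \<nu>' j = \<nu> j" by auto
    have "\<nu>' j = \<nu> j" if "j \<noteq> i" for j
      using p(2)[of j] p(3)[of j] that by (cases "j < r") auto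
    then have "\<nu>' = \<nu>(i := \<nu>' i)" by auto
    then show "p \<in> ?L" using p(1) p(2)[OF assms(1)] unfolding on_register_def by auto
  qed (use assms(1) in \<open>auto simp: on_register_def\<close>)
  moreover have "\<exists>B. queue_impl r ?R B"
    by (rule queue_impl_pointwise[where A="\<lambda>j. if j = i then A else range copy_word"])
      (use assms(2) rotates_block_copy in auto)
  ultimately show ?thesis by simp
qed

definition inc :: "nat \<Rightarrow> (nat \<Rightarrow> nat) rel" where
  "inc i = on_register i {(x, Suc x) |x. True}"

definition dec :: "nat \<Rightarrow> (nat \<Rightarrow> nat) rel" where
  "dec i = on_register i {(Suc x, x) |x. True}"

definition zero_test :: "nat \<Rightarrow> (nat \<Rightarrow> nat) rel" where
  "zero_test i = on_register i {(0, 0)}"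

inductive counter_prog :: "nat \<Rightarrow> (nat \<Rightarrow> nat) rel \<Rightarrow> bool" for r where
  counter_prog_empty: "counter_prog r {}"
| counter_prog_Id: "counter_prog r Id"
| counter_prog_inc: "i < r \<Longrightarrow> counter_prog r (inc i)"
| counter_prog_dec: "i < r \<Longrightarrow> counter_prog r (dec i)"
| counter_prog_zero_test: "i < r \<Longrightarrow> counter_prog r (zero_test i)"
| counter_prog_relcomp: "counter_prog r \<rho> \<Longrightarrow> counter_prog r \<sigma> \<Longrightarrow> counter_prog r (\<rho> O \<sigma>)"
| counter_prog_rtrancl: "counter_prog r \<rho> \<Longrightarrow> counter_prog r (\<rho>\<^sup>*)"

lemma counter_prog_mono: "counter_prog r \<rho> \<Longrightarrow> r \<le> r' \<Longrightarrow> counter_prog r' \<rho>"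
  by (induction rule: counter_prog.induct) (auto intro: counter_prog.intros)

lemma counter_prog_queue_impl: "counter_prog r \<rho> \<Longrightarrow> \<exists>A. queue_impl r \<rho> A"
proof (induction rule: counter_prog.induct)
  case (counter_prog_inc i)
  then show ?case unfolding inc_def using rotates_block_inc by (rule queue_impl_on_register)
next
  case (counter_prog_dec i)
  then show ?case unfolding dec_def using rotates_block_dec by (rule queue_impl_on_register)
next
  case (counter_prog_zero_test i)
  then show ?case unfolding zero_test_def using rotates_block_zero by (rule queue_impl_on_register)
qed (blast intro: queue_impl_empty queue_impl_Id queue_impl_relcomp queue_impl_rtrancl)+

section \<open>Register programs for recursive functions\<close>

definition program :: "(nat \<Rightarrow> nat) rel \<Rightarrow> bool" where
  "program \<rho> \<longleftrightarrow> (\<exists>r. counter_prog r \<rho>)"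

lemma program_basic:
  "program {}" "program Id" "program (inc i)" "program (dec i)" "program (zero_test i)"
  unfolding program_def by (blast intro: counter_prog.intros lessI)+

lemma program_relcomp: "program \<rho> \<Longrightarrow> program \<sigma> \<Longrightarrow> program (\<rho> O \<sigma>)"
  unfolding program_def
  by (meson counter_prog_mono counter_prog_relcomp max.cobounded1 max.cobounded2)

lemma program_rtrancl: "program \<rho> \<Longrightarrow> program (\<rho>\<^sup>*)"
  unfolding program_def by (blast intro: counter_prog_rtrancl)

lemma inc_Image: "inc i `` {\<nu>} = {\<nu>(i := Suc (\<nu> i))}"
  by (auto simp: inc_def on_register_def)

lemma dec_Image: "dec i `` {\<nu>} = (if \<nu> i = 0 then {} else {\<nu>(i := \<nu> i - 1)})"
  by (cases "\<nu> i") (auto simp: dec_def on_register_def)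

lemma zero_test_eq: "zero_test i = Id_on {\<nu>. \<nu> i = 0}"
proof -
  have "(\<nu>, \<nu>') \<in> zero_test i \<longleftrightarrow> \<nu> i = 0 \<and> \<nu>' = \<nu>(i := 0)" for \<nu> \<nu>'
    by (auto simp: zero_test_def on_register_def)
  then show ?thesis by (auto simp: fun_upd_idem)
qed

lemma Image_image: "r `` (f ` A) = (\<Union>x\<in>A. r `` {f x})"
  by auto

lemma rtrancl_Image_image:
  assumes "\<And>a. \<rho> `` {f a} = f ` (\<sigma> `` {a})"
  shows "\<rho>\<^sup>* `` (f ` A) = f ` (\<sigma>\<^sup>* `` A)"
proof (intro equalityI subsetI)
  fix y assume "y \<in> \<rho>\<^sup>* `` (f ` A)"
  then obtain a where a: "a \<in> A" "(f a, y) \<in> \<rho>\<^sup>*" by blast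
  from a(2) show "y \<in> f ` (\<sigma>\<^sup>* `` A)"
  proof (induction rule: rtrancl_induct)
    case base
    show ?case using a(1) by blast
  next
    case (step y z)
    then obtain b where b: "b \<in> \<sigma>\<^sup>* `` A" "y = f b" by blast
    with step(2) assms obtain c where "(b, c) \<in> \<sigma>" "z = f c" by blast
    with b(1) show ?case by (blast intro: rtrancl_into_rtrancl)
  qed
next
  fix y assume "y \<in> f ` (\<sigma>\<^sup>* `` A)"
  then obtain a b where ab: "a \<in> A" "(a, b) \<in> \<sigma>\<^sup>*" "y = f b" by blast
  have "(f a, f b) \<in> \<rho>\<^sup>*"
    using ab(2)
  proof (induction rule: rtrancl_induct)
    case (step b c)
    have "(f b, f c) \<in> \<rho>" using step(2) assms by blast
    with step(3) show ?case by (rule rtrancl_into_rtrancl)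
  qed simp
  with ab(1,3) show "y \<in> \<rho>\<^sup>* `` (f ` A)" by blast
qed

subsection \<open>Moving the contents of registers\<close>

definition transfer :: "nat set \<Rightarrow> nat set \<Rightarrow> nat \<Rightarrow> (nat \<Rightarrow> nat) rel" where
  "transfer S D k = {(\<nu>, \<lambda>j. if j \<in> S then \<nu> j - k else if j \<in> D then \<nu> j + k else \<nu> j) |\<nu>.
     \<forall>s \<in> S. k \<le> \<nu> s}"

text \<open>All registers in \<open>S\<close> must hold the same number, so that a flush from two registers is also an
  equality test.\<close>

definition flush :: "nat set \<Rightarrow> nat set \<Rightarrow> (nat \<Rightarrow> nat) rel" where
  "flush S D = {(\<nu>, \<lambda>j. if j \<in> S then 0 else if j \<in> D then \<nu> j + k else \<nu> j) |\<nu> k.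
     \<forall>s \<in> S. \<nu> s = k}"

lemma transfer_Image: "transfer S D k `` {\<nu>} = (if \<forall>s \<in> S. k \<le> \<nu> s
    then {\<lambda>j. if j \<in> S then \<nu> j - k else if j \<in> D then \<nu> j + k else \<nu> j} else {})"
  unfolding transfer_def by auto

lemma transfer_0: "transfer S D 0 = Id"
  by (auto simp: transfer_def fun_eq_iff)

lemma transfer_add:
  assumes "S \<inter> D = {}"
  shows "transfer S D k O transfer S D l = transfer S D (k + l)"
proof (intro equalityI subsetI)
  fix p assume "p \<in> transfer S D k O transfer S D l"
  then show "p \<in> transfer S D (k + l)"
    using assms by (fastforce simp: transfer_def)
next
  fix p assume "p \<in> transfer S D (k + l)"
  then obtain \<nu> \<nu>'' where p: "p = (\<nu>, \<nu>'')" "\<forall>s \<in> S. k + l \<le> \<nu> s"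
    "\<nu>'' = (\<lambda>j. if j \<in> S then \<nu> j - (k + l) else if j \<in> D then \<nu> j + (k + l) else \<nu> j)"
    unfolding transfer_def by blast
  define \<nu>' where "\<nu>' = (\<lambda>j. if j \<in> S then \<nu> j - k else if j \<in> D then \<nu> j + k else \<nu> j)"
  have "(\<nu>, \<nu>') \<in> transfer S D k" using p(2) by (force simp: transfer_def \<nu>'_def)
  moreover have "(\<nu>', \<nu>'') \<in> transfer S D l"
    using p(2,3) by (force simp: transfer_def \<nu>'_def)
  ultimately show "p \<in> transfer S D k O transfer S D l" unfolding p(1) by blast
qed

lemma rtrancl_transfer:
  assumes "S \<inter> D = {}"
  shows "(transfer S D 1)\<^sup>* = (\<Union>k. transfer S D k)"
proof -
  have "transfer S D 1 ^^ k = transfer S D k" for k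
    by (induction k) (simp_all add: transfer_0 transfer_add[OF assms])
  then show ?thesis by (simp add: rtrancl_is_UN_relpow)
qed

lemma program_transfer_1:
  assumes "finite S" "finite D" "S \<inter> D = {}"
  shows "program (transfer S D 1)"
  using assms
proof (induction S rule: finite_induct)
  case empty
  from empty(1) show ?case
  proof (induction D rule: finite_induct)
    case empty
    have "transfer {} {} 1 = Id" by (auto simp: transfer_def)
    then show ?case by (simp add: program_basic)
  next
    case (insert d D)
    have "transfer {} (insert d D) 1 `` {\<nu>} = (inc d O transfer {} D 1) `` {\<nu>}" for \<nu>
      using insert(2) by (auto simp: relcomp_Image inc_Image transfer_Image fun_eq_iff)
    then have "transfer {} (insert d D) 1 = inc d O transfer {} D 1" by (auto simp: Image_singleton)
    then show ?case using insert by (simp add: program_basic program_relcomp)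
  qed
next
  case (insert s S)
  have "transfer (insert s S) D 1 `` {\<nu>} = (dec s O transfer S D 1) `` {\<nu>}" for \<nu>
    using insert by (auto simp: relcomp_Image dec_Image transfer_Image fun_eq_iff)
  then have "transfer (insert s S) D 1 = dec s O transfer S D 1" by (auto simp: Image_singleton)
  then show ?case using insert by (simp add: program_basic program_relcomp)
qed

lemma program_zero_tests: "finite S \<Longrightarrow> program (Id_on {\<nu>. \<forall>s \<in> S. \<nu> s = 0})"
proof (induction S rule: finite_induct)
  case empty
  have "Id_on {\<nu> :: nat \<Rightarrow> nat. \<forall>s \<in> {}. \<nu> s = 0} = Id" by auto
  then show ?case by (simp add: program_basic)
next
  case (insert s S)
  have "Id_on {\<nu>. \<forall>s \<in> insert s S. \<nu> s = 0} = zero_test s O Id_on {\<nu>. \<forall>s \<in> S. \<nu> s = 0}"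
    by (auto simp: zero_test_eq)
  then show ?case using insert by (simp add: program_basic program_relcomp)
qed

lemma program_flush:
  assumes "finite S" "finite D" "S \<inter> D = {}"
  shows "program (flush S D)"
proof -
  have "flush S D = (\<Union>k. transfer S D k) O Id_on {\<nu>. \<forall>s \<in> S. \<nu> s = 0}" (is "_ = ?R")
  proof (intro equalityI subsetI)
    fix p assume "p \<in> flush S D"
    then obtain \<nu> \<nu>' k where p: "p = (\<nu>, \<nu>')" "\<forall>s \<in> S. \<nu> s = k"
      "\<nu>' = (\<lambda>j. if j \<in> S then 0 else if j \<in> D then \<nu> j + k else \<nu> j)"
      by (auto simp: flush_def)
    then have "(\<nu>, \<nu>') \<in> transfer S D k" by (force simp: transfer_def)
    moreover have "\<forall>s \<in> S. \<nu>' s = 0" using p(3) by simp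
    ultimately show "p \<in> ?R" using p(1) by blast
  next
    fix p assume "p \<in> ?R"
    then obtain \<nu> \<nu>' k where p: "p = (\<nu>, \<nu>')" "(\<nu>, \<nu>') \<in> transfer S D k" "\<forall>s \<in> S. \<nu>' s = 0"
      by blast
    from p(2,3) have "\<forall>s \<in> S. \<nu> s = k" by (fastforce simp: transfer_def)
    with p show "p \<in> flush S D" by (force simp: transfer_def flush_def)
  qed
  also have "\<dots> = (transfer S D 1)\<^sup>* O Id_on {\<nu>. \<forall>s \<in> S. \<nu> s = 0}"
    by (simp only: rtrancl_transfer[OF assms(3)])
  finally show ?thesis
    using assms
    by (simp only: program_relcomp program_rtrancl program_transfer_1 program_zero_tests)
qed

lemma flush_Image:
  assumes "s \<in> S"
  shows "flush S D `` {\<nu>} = (if \<forall>s' \<in> S. \<nu> s' = \<nu> s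
    then {\<lambda>j. if j \<in> S then 0 else if j \<in> D then \<nu> j + \<nu> s else \<nu> j} else {})"
  using assms unfolding flush_def by auto

lemma clear_Image: "flush {i} {} `` {\<nu>} = {\<nu>(i := 0)}"
  unfolding flush_Image[OF singletonI] by (auto simp: fun_eq_iff)

lemma move_Image: "i \<noteq> j \<Longrightarrow> flush {i} {j} `` {\<nu>} = {\<nu>(i := 0, j := \<nu> j + \<nu> i)}"
  unfolding flush_Image[OF singletonI] by (auto simp: fun_eq_iff)

definition add_register :: "nat \<Rightarrow> nat \<Rightarrow> nat \<Rightarrow> (nat \<Rightarrow> nat) rel" where
  "add_register i j t = flush {i} {j, t} O flush {t} {i}"

definition equality_test :: "nat \<Rightarrow> nat \<Rightarrow> nat \<Rightarrow> (nat \<Rightarrow> nat) rel" where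
  "equality_test i j t = flush {i, j} {t} O flush {t} {i, j}"

lemma program_add_register: "distinct [i, j, t] \<Longrightarrow> program (add_register i j t)"
  unfolding add_register_def by (intro program_relcomp program_flush) auto

lemma program_equality_test: "distinct [i, j, t] \<Longrightarrow> program (equality_test i j t)"
  unfolding equality_test_def by (intro program_relcomp program_flush) auto

lemma add_register_Image:
  assumes "distinct [i, j, t]" "\<nu> t = 0"
  shows "add_register i j t `` {\<nu>} = {\<nu>(j := \<nu> j + \<nu> i)}"
proof -
  have "flush {i} {j, t} `` {\<nu>} = {\<nu>(i := 0, j := \<nu> j + \<nu> i, t := \<nu> i)}"
    unfolding flush_Image[OF singletonI] using assms by (auto simp: fun_eq_iff)
  then show ?thesis
    using assms by (auto simp: add_register_def relcomp_Image move_Image fun_eq_iff)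
qed

lemma equality_test_Image:
  assumes "distinct [i, j, t]" "\<nu> t = 0"
  shows "equality_test i j t `` {\<nu>} = (if \<nu> i = \<nu> j then {\<nu>} else {})"
proof -
  have flush: "flush {i, j} {t} `` {\<nu>} =
      (if \<nu> i = \<nu> j then {\<nu>(i := 0, j := 0, t := \<nu> i)} else {})"
    unfolding flush_Image[OF insertI1] using assms by (auto simp: fun_eq_iff)
  have unflush: "flush {t} {i, j} `` {\<nu>(i := 0, j := 0, t := \<nu> i)} = {\<nu>(j := \<nu> i)}"
    unfolding flush_Image[OF singletonI] using assms by (auto simp: fun_eq_iff)
  show ?thesis unfolding equality_test_def relcomp_Image flush using unflush by auto
qed

subsection \<open>Implementing recursive functions\<close>

text \<open>The registers from \<open>t\<close> on are scratch space, zero before and after the computation.\<close>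

definition implements :: "recf \<Rightarrow> nat list \<Rightarrow> nat \<Rightarrow> nat \<Rightarrow> (nat \<Rightarrow> nat) rel \<Rightarrow> bool" where
  "implements f ins out t \<rho> \<longleftrightarrow> program \<rho> \<and>
     (\<forall>\<nu>. (\<forall>j\<ge>t. \<nu> j = 0) \<longrightarrow> \<nu> out = 0 \<longrightarrow>
        \<rho> `` {\<nu>} = (\<lambda>z. \<nu>(out := z)) ` {z. reval f (map \<nu> ins) z})"

lemma implements_program: "implements f ins out t \<rho> \<Longrightarrow> program \<rho>"
  by (simp add: implements_def)

lemma implements_Image:
  assumes "implements f ins out t \<rho>" "\<And>j. t \<le> j \<Longrightarrow> \<nu> j = 0" "\<nu> out = 0"
  shows "\<rho> `` {\<nu>} = (\<lambda>z. \<nu>(out := z)) ` {z. reval f (map \<nu> ins) z}"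
  using assms unfolding implements_def by auto

definition implementable :: "recf \<Rightarrow> bool" where
  "implementable f \<longleftrightarrow> (\<forall>ins out t. (\<forall>i \<in> set ins. i < t) \<longrightarrow> out < t \<longrightarrow> out \<notin> set ins \<longrightarrow>
     (\<exists>\<rho>. implements f ins out t \<rho>))"

lemma implementableI:
  assumes "\<And>ins out t. (\<And>i. i \<in> set ins \<Longrightarrow> i < t) \<Longrightarrow> out < t \<Longrightarrow> out \<notin> set ins \<Longrightarrow>
    \<exists>\<rho>. implements f ins out t \<rho>"
  shows "implementable f"
  using assms unfolding implementable_def by blast

lemma implementableE:
  assumes "implementable f" "\<And>i. i \<in> set ins \<Longrightarrow> i < t" "out < t" "out \<notin> set ins"
  obtains \<rho> where "implements f ins out t \<rho>"
  using assms unfolding implementable_def by blast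

lemma implementable_RZero: "implementable RZero"
proof (rule implementableI)
  fix ins out t
  show "\<exists>\<rho>. implements RZero ins out t \<rho>"
    by (rule exI[of _ Id]) (auto simp: implements_def program_basic reval_RZero_iff fun_eq_iff)
qed

lemma implements_if_undefined:
  "(\<And>xs z. length xs = length ins \<Longrightarrow> \<not> reval f xs z) \<Longrightarrow> implements f ins out t {}"
  by (simp add: implements_def program_basic)

lemma implementable_RProj: "implementable (RProj i)"
proof (rule implementableI)
  fix ins :: "nat list" and out t :: nat
  assume regs: "\<And>i. i \<in> set ins \<Longrightarrow> i < t" "out < t" "out \<notin> set ins"
  show "\<exists>\<rho>. implements (RProj i) ins out t \<rho>"
  proof (cases "i < length ins")
    case True
    then have dist: "distinct [ins ! i, out, t]" using regs nth_mem[OF True] by fastforce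
    have "implements (RProj i) ins out t (add_register (ins ! i) out t)"
      unfolding implements_def
      using dist True by (auto simp: program_add_register add_register_Image reval_RProj_iff)
    then show ?thesis by blast
  next
    case False
    then show ?thesis
      by (intro exI[of _ "{}"] implements_if_undefined) (auto simp: reval_RProj_iff)
  qed
qed

lemma implementable_RSucc: "implementable RSucc"
proof (rule implementableI)
  fix ins :: "nat list" and out t :: nat
  assume regs: "\<And>i. i \<in> set ins \<Longrightarrow> i < t" "out < t" "out \<notin> set ins"
  show "\<exists>\<rho>. implements RSucc ins out t \<rho>"
  proof (cases ins)
    case Nil
    then show ?thesis
      by (intro exI[of _ "{}"] implements_if_undefined) (auto simp: reval_RSucc_iff)
  next
    case (Cons i js)
    then have dist: "distinct [i, out, t]" using regs by fastforce
    have "implements RSucc ins out t (add_register i out t O inc out)"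
      unfolding implements_def using dist Cons
      by (auto simp: program_relcomp program_basic program_add_register relcomp_Image
          add_register_Image inc_Image reval_RSucc_iff)
    then show ?thesis by blast
  qed
qed

definition store :: "(nat \<Rightarrow> nat) \<Rightarrow> nat \<Rightarrow> nat list \<Rightarrow> nat \<Rightarrow> nat" where
  "store \<nu> s ys = (\<lambda>j. if s \<le> j \<and> j < s + length ys then ys ! (j - s) else \<nu> j)"

lemma map_store: "map (store \<nu> s ys) [s..<s + length ys] = ys"
  by (rule nth_equalityI) (auto simp: store_def)

lemma store_Cons: "store (\<nu>(s := y)) (Suc s) ys = store \<nu> s (y # ys)"
  by (auto simp: store_def fun_eq_iff nth_Cons' Suc_diff_Suc)

lemma ex_program_store:
  assumes "\<And>g. g \<in> set gs \<Longrightarrow> implementable g" "\<And>i. i \<in> set ins \<Longrightarrow> i < s"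
  shows "\<exists>\<rho>. program \<rho> \<and> (\<forall>\<nu>. (\<forall>j\<ge>s. \<nu> j = 0) \<longrightarrow>
    \<rho> `` {\<nu>} = store \<nu> s ` {ys. list_all2 (\<lambda>g y. reval g (map \<nu> ins) y) gs ys})"
  using assms
proof (induction gs arbitrary: s)
  case Nil
  have "store \<nu> s [] = \<nu>" for \<nu> by (auto simp: store_def)
  then show ?case by (intro exI[of _ Id]) (auto intro: program_basic)
next
  case (Cons g gs)
  obtain \<rho> where \<rho>: "implements g ins s (Suc s) \<rho>"
    using implementableE[of g ins "Suc s" s] Cons.prems
    by (metis less_Suc_eq list.set_intros(1) less_irrefl)
  obtain \<sigma> where \<sigma>: "program \<sigma>" "\<And>\<nu>. (\<forall>j\<ge>Suc s. \<nu> j = 0) \<Longrightarrow>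
      \<sigma> `` {\<nu>} = store \<nu> (Suc s) ` {ys. list_all2 (\<lambda>g y. reval g (map \<nu> ins) y) gs ys}"
    using Cons.IH[of "Suc s"] Cons.prems by (metis less_Suc_eq list.set_intros(2))
  have "(\<rho> O \<sigma>) `` {\<nu>} = store \<nu> s ` {ys. list_all2 (\<lambda>g y. reval g (map \<nu> ins) y) (g # gs) ys}"
    if \<nu>: "\<forall>j\<ge>s. \<nu> j = 0" for \<nu>
  proof -
    have ins: "map (\<nu>(s := y)) ins = map \<nu> ins" for y using Cons.prems(2) by auto
    have "\<sigma> `` {\<nu>(s := y)} =
        (\<lambda>ys. store \<nu> s (y # ys)) ` {ys. list_all2 (\<lambda>g y. reval g (map \<nu> ins) y) gs ys}" for y
      using \<sigma>(2)[of "\<nu>(s := y)"] \<nu> by (simp add: ins store_Cons)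
    moreover have "\<rho> `` {\<nu>} = (\<lambda>y. \<nu>(s := y)) ` {y. reval g (map \<nu> ins) y}"
      using implements_Image[OF \<rho>] \<nu> by simp
    ultimately show ?thesis by (auto simp: relcomp_Image Image_image list_all2_Cons1)
  qed
  then show ?case using program_relcomp[OF implements_program[OF \<rho>] \<sigma>(1)] by blast
qed

lemma ex_program_clear:
  assumes "finite A"
  shows "\<exists>\<rho>. program \<rho> \<and> (\<forall>\<nu>. \<rho> `` {\<nu>} = {\<lambda>j. if j \<in> A then 0 else \<nu> j})"
  using assms
proof (induction A rule: finite_induct)
  case empty
  show ?case by (rule exI[of _ Id]) (auto intro: program_basic)
next
  case (insert a A)
  then obtain \<rho> where \<rho>: "program \<rho>" "\<And>\<nu>. \<rho> `` {\<nu>} = {\<lambda>j. if j \<in> A then 0 else \<nu> j}" by blast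
  have "(\<rho> O flush {a} {}) `` {\<nu>} = {\<lambda>j. if j \<in> insert a A then 0 else \<nu> j}" for \<nu>
    by (auto simp: relcomp_Image \<rho>(2) clear_Image fun_eq_iff)
  moreover have "program (\<rho> O flush {a} {})"
    using \<rho>(1) by (simp add: program_relcomp program_flush)
  ultimately show ?case by blast
qed

lemma implementable_RComp:
  assumes f: "implementable f" and gs: "\<And>g. g \<in> set gs \<Longrightarrow> implementable g"
  shows "implementable (RComp f gs)"
proof (rule implementableI)
  fix ins :: "nat list" and out t :: nat
  assume regs: "\<And>i. i \<in> set ins \<Longrightarrow> i < t" "out < t" "out \<notin> set ins"
  let ?m = "length gs"
  let ?G = "\<lambda>\<nu>. {ys. list_all2 (\<lambda>g y. reval g (map \<nu> ins) y) gs ys}"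
  obtain \<rho> where \<rho>: "program \<rho>" "\<And>\<nu>. (\<forall>j\<ge>t. \<nu> j = 0) \<Longrightarrow> \<rho> `` {\<nu>} = store \<nu> t ` ?G \<nu>"
    using ex_program_store[of gs ins t] gs regs(1) by blast
  obtain \<sigma> where \<sigma>: "implements f [t..<t + ?m] out (t + ?m) \<sigma>"
    by (rule implementableE[OF f, of "[t..<t + ?m]" "t + ?m" out]) (use regs(2) in auto)
  obtain \<kappa> where \<kappa>: "program \<kappa>" "\<And>\<nu>. \<kappa> `` {\<nu>} = {\<lambda>j. if j \<in> {t..<t + ?m} then 0 else \<nu> j}"
    using ex_program_clear[of "{t..<t + ?m}"] by blast
  have "(\<rho> O \<sigma> O \<kappa>) `` {\<nu>} = (\<lambda>z. \<nu>(out := z)) ` {z. reval (RComp f gs) (map \<nu> ins) z}"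
    if \<nu>: "\<forall>j\<ge>t. \<nu> j = 0" "\<nu> out = 0" for \<nu>
  proof -
    have "(\<sigma> O \<kappa>) `` {store \<nu> t ys} = (\<lambda>z. \<nu>(out := z)) ` {z. reval f ys z}" if "ys \<in> ?G \<nu>" for ys
    proof -
      have len: "length ys = ?m" using that by (simp add: list_all2_lengthD)
      have "\<sigma> `` {store \<nu> t ys} = (\<lambda>z. (store \<nu> t ys)(out := z)) ` {z. reval f ys z}"
        using implements_Image[OF \<sigma>, of "store \<nu> t ys"] \<nu> regs(2) map_store[of \<nu> t ys]
        by (simp add: len) (simp add: store_def len)
      moreover have "(\<lambda>j. if j \<in> {t..<t + ?m} then 0 else ((store \<nu> t ys)(out := z)) j) = \<nu>(out := z)"
        for z
        using \<nu> regs(2) len by (intro ext) (auto simp: store_def)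
      ultimately show ?thesis by (auto simp: relcomp_Image Image_image \<kappa>(2))
    qed
    then have "(\<rho> O \<sigma> O \<kappa>) `` {\<nu>} = (\<Union>ys \<in> ?G \<nu>. (\<lambda>z. \<nu>(out := z)) ` {z. reval f ys z})"
      unfolding relcomp_Image[of \<rho>] \<rho>(2)[OF \<nu>(1)] Image_image by simp
    then show ?thesis by (auto simp: reval_RComp_iff)
  qed
  moreover have "program (\<rho> O \<sigma> O \<kappa>)"
    using \<rho>(1) implements_program[OF \<sigma>] \<kappa>(1) by (intro program_relcomp)
  ultimately show "\<exists>\<rho>. implements (RComp f gs) ins out t \<rho>" unfolding implements_def by blast
qed

lemma reval_RPrim_rtrancl:
  "{((n, y), (Suc n, z)) |n y z. reval g (y # n # xs) z}\<^sup>* `` ({0} \<times> {y. reval f xs y}) =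
    {(n, y). reval (RPrim f g) (n # xs) y}" (is "?\<sigma>\<^sup>* `` ?A = ?R")
proof (intro equalityI subsetI)
  fix p assume "p \<in> ?\<sigma>\<^sup>* `` ?A"
  then obtain y0 where "reval f xs y0" "((0, y0), p) \<in> ?\<sigma>\<^sup>*" by blast
  from this(2) show "p \<in> ?R"
    by (induction rule: rtrancl_induct)
      (use \<open>reval f xs y0\<close> in \<open>auto simp: reval_RPrim_0_iff reval_RPrim_Suc_iff\<close>)
next
  have "(n, y) \<in> ?\<sigma>\<^sup>* `` ?A" if "reval (RPrim f g) (n # xs) y" for n y
    using that
  proof (induction n arbitrary: y)
    case 0
    then show ?case by (auto simp: reval_RPrim_0_iff)
  next
    case (Suc n)
    then obtain y' where y': "reval (RPrim f g) (n # xs) y'" "reval g (y' # n # xs) y"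
      by (auto simp: reval_RPrim_Suc_iff)
    have "((n, y'), (Suc n, y)) \<in> ?\<sigma>" using y'(2) by blast
    with Suc.IH[OF y'(1)] show ?case by (blast intro: rtrancl_into_rtrancl)
  qed
  then show "p \<in> ?R \<Longrightarrow> p \<in> ?\<sigma>\<^sup>* `` ?A" for p by blast
qed

text \<open>Register \<open>t\<close> counts the iterations, and register \<open>t + 1\<close> holds the current value. The number
  of iterations is guessed; the equality test rejects wrong guesses.\<close>

definition prim_body :: "nat \<Rightarrow> (nat \<Rightarrow> nat) rel \<Rightarrow> (nat \<Rightarrow> nat) rel" where
  "prim_body t \<sigma> = \<sigma> O flush {t + 1} {} O flush {t + 2} {t + 1} O inc t"

definition prim_exit :: "nat \<Rightarrow> nat \<Rightarrow> nat \<Rightarrow> (nat \<Rightarrow> nat) rel" where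
  "prim_exit t i out = equality_test t i (t + 2) O flush {t + 1} {out} O flush {t} {}"

lemma prim_body_Image:
  assumes \<sigma>: "implements g ((t + 1) # t # js) (t + 2) (t + 3) \<sigma>"
    and js: "\<And>j. j \<in> set js \<Longrightarrow> j < t" and \<nu>: "\<And>j. t \<le> j \<Longrightarrow> \<nu> j = 0"
  shows "prim_body t \<sigma> `` {\<nu>(t := n, t + 1 := y)} =
    (\<lambda>z. \<nu>(t := Suc n, t + 1 := z)) ` {z. reval g (y # n # map \<nu> js) z}"
proof -
  let ?\<mu> = "\<nu>(t := n, t + 1 := y)"
  have "map ?\<mu> ((t + 1) # t # js) = y # n # map \<nu> js" using js by fastforce
  from implements_Image[OF \<sigma>, of ?\<mu>, unfolded this]
  have "\<sigma> `` {?\<mu>} = (\<lambda>z. ?\<mu>(t + 2 := z)) ` {z. reval g (y # n # map \<nu> js) z}"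
    using \<nu> by simp
  moreover have "(flush {t + 1} {} O flush {t + 2} {t + 1} O inc t) `` {?\<mu>(t + 2 := z)} =
      {\<nu>(t := Suc n, t + 1 := z)}" for z
    using \<nu> by (auto simp: relcomp_Image clear_Image move_Image inc_Image fun_eq_iff)
  ultimately show ?thesis by (auto simp: prim_body_def relcomp_Image[of \<sigma>] Image_image)
qed

lemma prim_exit_Image:
  assumes "i < t" "out < t" "\<nu> out = 0" "\<And>j. t \<le> j \<Longrightarrow> \<nu> j = 0"
  shows "prim_exit t i out `` {\<nu>(t := n, t + 1 := y)} = (if n = \<nu> i then {\<nu>(out := y)} else {})"
proof -
  have "equality_test t i (t + 2) `` {\<nu>(t := n, t + 1 := y)} =
      (if n = \<nu> i then {\<nu>(t := n, t + 1 := y)} else {})"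
    using assms by (subst equality_test_Image) auto
  then show ?thesis
    using assms by (auto simp: prim_exit_def relcomp_Image clear_Image move_Image fun_eq_iff)
qed

lemma implements_RPrim:
  assumes \<rho>: "implements f js (t + 1) (t + 3) \<rho>"
    and \<sigma>: "implements g ((t + 1) # t # js) (t + 2) (t + 3) \<sigma>"
    and regs: "\<And>j. j \<in> set (i # js) \<Longrightarrow> j < t" "out < t"
  shows "implements (RPrim f g) (i # js) out t (\<rho> O (prim_body t \<sigma>)\<^sup>* O prim_exit t i out)"
    (is "implements _ _ _ _ ?\<pi>")
proof -
  have "?\<pi> `` {\<nu>} = (\<lambda>z. \<nu>(out := z)) ` {z. reval (RPrim f g) (map \<nu> (i # js)) z}"
    if \<nu>: "\<forall>j\<ge>t. \<nu> j = 0" "\<nu> out = 0" for \<nu>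
  proof -
    let ?xs = "map \<nu> js"
    let ?st = "\<lambda>(n, y). \<nu>(t := n, t + 1 := y)"
    let ?step = "{((n, y), (Suc n, z)) |n y z. reval g (y # n # ?xs) z}"
    have init: "\<rho> `` {\<nu>} = ?st ` ({0} \<times> {y. reval f ?xs y})"
    proof -
      have "\<nu>(t := 0) = \<nu>" using \<nu>(1) by auto
      then have "\<rho> `` {\<nu>} = (\<lambda>y. ?st (0, y)) ` {y. reval f ?xs y}"
        using implements_Image[OF \<rho>, of \<nu>] \<nu>(1) by simp
      moreover have "{0 :: nat} \<times> {y. reval f ?xs y} = Pair 0 ` {y. reval f ?xs y}" by auto
      ultimately show ?thesis by (simp only: image_image)
    qed
    have "prim_body t \<sigma> `` {?st a} = ?st ` (?step `` {a})" for a
      using prim_body_Image[OF \<sigma>, of \<nu>] regs(1) \<nu>(1) by (cases a) force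
    then have loop: "(prim_body t \<sigma>)\<^sup>* `` (?st ` ({0} \<times> {y. reval f ?xs y})) =
        ?st ` {(n, y). reval (RPrim f g) (n # ?xs) y}"
      by (simp only: rtrancl_Image_image reval_RPrim_rtrancl)
    have exit: "prim_exit t i out `` {?st p} = (if fst p = \<nu> i then {\<nu>(out := snd p)} else {})" for p
      using prim_exit_Image[of i t out \<nu>] regs \<nu> by (cases p) simp
    show ?thesis
      unfolding relcomp_Image init loop unfolding Image_image exit by (auto split: if_splits)
  qed
  moreover have "program ?\<pi>"
    using implements_program[OF \<rho>] implements_program[OF \<sigma>] regs(2) regs(1)[of i]
    unfolding prim_body_def prim_exit_def
    by (intro program_relcomp program_rtrancl program_flush program_equality_test program_basic) auto
  ultimately show ?thesis unfolding implements_def by blast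
qed

lemma implementable_RPrim:
  assumes f: "implementable f" and g: "implementable g"
  shows "implementable (RPrim f g)"
proof (rule implementableI)
  fix ins :: "nat list" and out t :: nat
  assume regs: "\<And>i. i \<in> set ins \<Longrightarrow> i < t" "out < t" "out \<notin> set ins"
  show "\<exists>\<rho>. implements (RPrim f g) ins out t \<rho>"
  proof (cases ins)
    case Nil
    then show ?thesis
      by (intro exI[of _ "{}"] implements_if_undefined) (simp add: reval_RPrim_Nil_iff)
  next
    case (Cons i js)
    have js: "j < t" if "j \<in> set js" for j using that regs(1) Cons by simp
    obtain \<rho> where \<rho>: "implements f js (t + 1) (t + 3) \<rho>"
      by (rule implementableE[OF f, of js "t + 3" "t + 1"]) (use js in fastforce)+
    obtain \<sigma> where \<sigma>: "implements g ((t + 1) # t # js) (t + 2) (t + 3) \<sigma>"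
      by (rule implementableE[OF g, of "(t + 1) # t # js" "t + 3" "t + 2"]) (use js in fastforce)+
    show ?thesis using implements_RPrim[OF \<rho> \<sigma>] regs(1,2) unfolding Cons by blast
  qed
qed

lemma rtrancl_Suc_Image: "{(k, Suc k) |k. P k}\<^sup>* `` {0} = {n. \<forall>k<n. P k}" (is "?\<sigma>\<^sup>* `` _ = _")
proof (intro equalityI subsetI)
  fix n assume "n \<in> ?\<sigma>\<^sup>* `` {0}"
  then have "(0, n) \<in> ?\<sigma>\<^sup>*" by blast
  then show "n \<in> {n. \<forall>k<n. P k}"
    by (induction rule: rtrancl_induct) (auto simp: less_Suc_eq)
next
  have "(0, n) \<in> ?\<sigma>\<^sup>*" if "\<forall>k<n. P k" for n
    using that by (induction n) (auto intro: rtrancl_into_rtrancl)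
  then show "n \<in> {n. \<forall>k<n. P k} \<Longrightarrow> n \<in> ?\<sigma>\<^sup>* `` {0}" for n by blast
qed

definition min_body :: "nat \<Rightarrow> (nat \<Rightarrow> nat) rel \<Rightarrow> (nat \<Rightarrow> nat) rel" where
  "min_body t \<rho> = \<rho> O dec (t + 1) O flush {t + 1} {} O inc t"

definition min_exit :: "nat \<Rightarrow> nat \<Rightarrow> (nat \<Rightarrow> nat) rel \<Rightarrow> (nat \<Rightarrow> nat) rel" where
  "min_exit t out \<rho> = \<rho> O zero_test (t + 1) O flush {t} {out}"

context
  fixes f ins t \<rho> and \<nu> :: "nat \<Rightarrow> nat"
  assumes \<rho>: "implements f (t # ins) (t + 1) (t + 2) \<rho>"
    and ins: "\<And>j. j \<in> set ins \<Longrightarrow> j < t" and \<nu>: "\<And>j. t \<le> j \<Longrightarrow> \<nu> j = 0"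
begin

lemma min_value_Image:
  "\<rho> `` {\<nu>(t := n)} = (\<lambda>z. \<nu>(t := n, t + 1 := z)) ` {z. reval f (n # map \<nu> ins) z}"
proof -
  have "map (\<nu>(t := n)) (t # ins) = n # map \<nu> ins" using ins by fastforce
  from implements_Image[OF \<rho>, of "\<nu>(t := n)", unfolded this] show ?thesis
    using \<nu> by simp
qed

lemma min_body_Image:
  "min_body t \<rho> `` {\<nu>(t := n)} =
    (if \<exists>z. z \<noteq> 0 \<and> reval f (n # map \<nu> ins) z then {\<nu>(t := Suc n)} else {})"
proof -
  have "(dec (t + 1) O flush {t + 1} {} O inc t) `` {\<nu>(t := n, t + 1 := z)} =
      (if z = 0 then {} else {\<nu>(t := Suc n)})" for z
    using \<nu> by (auto simp: relcomp_Image dec_Image clear_Image inc_Image fun_eq_iff)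
  then show ?thesis
    unfolding min_body_def relcomp_Image[of \<rho>] min_value_Image Image_image by auto
qed

lemma min_exit_Image:
  assumes "out < t" "\<nu> out = 0"
  shows "min_exit t out \<rho> `` {\<nu>(t := n)} =
    (if reval f (n # map \<nu> ins) 0 then {\<nu>(out := n)} else {})"
proof -
  have "(zero_test (t + 1) O flush {t} {out}) `` {\<nu>(t := n, t + 1 := z)} =
      (if z = 0 then {\<nu>(out := n)} else {})" for z
    using \<nu> assms by (auto simp: relcomp_Image zero_test_eq Image_Id_on move_Image fun_eq_iff)
  then show ?thesis
    unfolding min_exit_def relcomp_Image[of \<rho>] min_value_Image Image_image by auto
qed

end

lemma implements_RMin:
  assumes \<rho>: "implements f (t # ins) (t + 1) (t + 2) \<rho>"
    and regs: "\<And>j. j \<in> set ins \<Longrightarrow> j < t" "out < t"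
  shows "implements (RMin f) ins out t ((min_body t \<rho>)\<^sup>* O min_exit t out \<rho>)"
    (is "implements _ _ _ _ ?\<pi>")
proof -
  have "?\<pi> `` {\<nu>} = (\<lambda>z. \<nu>(out := z)) ` {z. reval (RMin f) (map \<nu> ins) z}"
    if \<nu>: "\<forall>j\<ge>t. \<nu> j = 0" "\<nu> out = 0" for \<nu>
  proof -
    let ?P = "\<lambda>k. \<exists>z. z \<noteq> 0 \<and> reval f (k # map \<nu> ins) z"
    let ?st = "\<lambda>n. \<nu>(t := n)"
    have "min_body t \<rho> `` {?st k} = ?st ` ({(k, Suc k) |k. ?P k} `` {k})" for k
    proof -
      have "{(k, Suc k) |k. P k} `` {k} = (if P k then {Suc k} else {})" for P by auto
      then show ?thesis using min_body_Image[OF \<rho> regs(1), of \<nu> k] \<nu>(1) by simp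
    qed
    then have "(min_body t \<rho>)\<^sup>* `` (?st ` {0}) = ?st ` {n. \<forall>k<n. ?P k}"
      by (simp only: rtrancl_Image_image rtrancl_Suc_Image)
    moreover have "?st ` {0} = {\<nu>}" using \<nu>(1) by (auto simp: fun_eq_iff)
    ultimately have loop: "(min_body t \<rho>)\<^sup>* `` {\<nu>} = ?st ` {n. \<forall>k<n. ?P k}" by simp
    have "min_exit t out \<rho> `` {?st n} =
        (if reval f (n # map \<nu> ins) 0 then {\<nu>(out := n)} else {})" for n
      using min_exit_Image[OF \<rho> regs(1) _ regs(2)] \<nu> by blast
    then show ?thesis
      unfolding relcomp_Image loop unfolding Image_image
      by (auto simp: reval_RMin_iff split: if_splits)
  qed
  moreover have "program ?\<pi>"
    using implements_program[OF \<rho>] regs(2) unfolding min_body_def min_exit_def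
    by (intro program_relcomp program_rtrancl program_flush program_basic) auto
  ultimately show ?thesis unfolding implements_def by blast
qed

lemma implementable_RMin:
  assumes f: "implementable f"
  shows "implementable (RMin f)"
proof (rule implementableI)
  fix ins :: "nat list" and out t :: nat
  assume regs: "\<And>i. i \<in> set ins \<Longrightarrow> i < t" "out < t" "out \<notin> set ins"
  obtain \<rho> where "implements f (t # ins) (t + 1) (t + 2) \<rho>"
    by (rule implementableE[OF f, of "t # ins" "t + 2" "t + 1"]) (use regs(1) in fastforce)+
  from implements_RMin[OF this regs(1,2)] show "\<exists>\<rho>. implements (RMin f) ins out t \<rho>" by blast
qed

theorem implementable_recf: "implementable f"
  by (induction f) (simp_all add: implementable_RZero implementable_RSucc implementable_RProj
      implementable_RComp implementable_RPrim implementable_RMin)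

subsection \<open>Halting as a queue language\<close>

abbreviation input :: "nat \<Rightarrow> nat \<Rightarrow> nat" where
  "input e \<equiv> (\<lambda>_. 0)(0 := e)"

lemma ex_halting_program:
  "\<exists>\<rho>. program \<rho> \<and>
    (\<forall>e. \<rho> `` {input e} = (if \<exists>z. reval f [e] z then {\<lambda>_. 0} else {}))"
proof -
  obtain \<rho> where \<rho>: "implements f [0] 1 2 \<rho>"
    by (rule implementableE[OF implementable_recf, of "[0]" 2 1 f]) auto
  have "\<rho> `` {input e} = (\<lambda>z. (input e)(1 := z)) ` {z. reval f [e] z}" for e
    using implements_Image[OF \<rho>, of "input e"] by simp
  moreover have "(flush {0} {} O flush {1} {}) `` {(input e)(1 := z)} = {\<lambda>_. 0}" for e z :: nat
    by (auto simp: relcomp_Image clear_Image fun_eq_iff)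
  ultimately have "(\<rho> O flush {0} {} O flush {1} {}) `` {input e} =
      (if \<exists>z. reval f [e] z then {\<lambda>_. 0} else {})" for e
    unfolding relcomp_Image[of \<rho>] by (auto simp: Image_image)
  moreover have "program (\<rho> O flush {0} {} O flush {1} {})"
    using implements_program[OF \<rho>] by (intro program_relcomp program_flush) auto
  ultimately show ?thesis by blast
qed

definition halting_lang :: "nat \<Rightarrow> (bool \<times> bool) list set \<Rightarrow> (bool \<times> bool) list set" where
  "halting_lang r A = {map (Pair True) (True # blocks (replicate r 0))} \<cdot> A \<cdot>
     {map (Pair False) (blocks (replicate (Suc r) 0))}"

lemma zero_registers: "regs (Suc r) (\<lambda>_. 0) = replicate (Suc r) (0 :: nat)"
  by (simp add: map_replicate_const)

lemma input_registers: "regs (Suc r) (input e) = e # replicate r (0 :: nat)"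
  by (auto intro!: nth_equalityI simp: nth_Cons' simp del: upt_Suc)

lemma blocks_input:
  "blocks (e # replicate r 0) = replicate e False @ True # blocks (replicate r 0)"
  by (simp add: block_def)

lemma halting_lang_complete:
  assumes "queue_impl (Suc r) \<rho> A" "(input e, \<lambda>_. 0) \<in> \<rho>"
  shows "\<exists>w \<in> halting_lang r A. qrun (replicate e False) w []"
proof -
  let ?start = "map (Pair True) (True # blocks (replicate r 0))"
    and ?finish = "map (Pair False) (blocks (replicate (Suc r) 0))"
  from queue_impl_complete[OF assms, unfolded input_registers zero_registers] obtain w where
    w: "w \<in> A" "qrun (blocks (e # replicate r 0)) w (blocks (replicate (Suc r) 0))" by blast
  have "qrun (replicate e False) ?start (blocks (e # replicate r 0))"
    unfolding blocks_input by (rule qrun_write_all)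
  moreover have "qrun (blocks (replicate (Suc r) 0)) ?finish []"
    by (rule qrun_consume_all)
  ultimately have "qrun (replicate e False) (?start @ w @ ?finish) []"
    using w(2) by (blast intro: qrun_append)
  then show ?thesis
    using w(1) unfolding halting_lang_def by (blast intro: concI)
qed

lemma halting_lang_sound:
  assumes impl: "queue_impl (Suc r) \<rho> A" and w: "w \<in> halting_lang r A"
    and eq: "replicate e False @ written w = consumed w"
  shows "(input e, \<lambda>_. 0) \<in> \<rho>"
proof -
  obtain a where a: "w = map (Pair True) (True # blocks (replicate r 0)) @ a @
      map (Pair False) (blocks (replicate (Suc r) 0))" "a \<in> A"
    using w unfolding halting_lang_def by (auto elim!: concE)
  have "transforms (Suc r) \<rho> a" using impl a(2) by (simp add: queue_impl_def)
  then obtain us vs where "consumed a = blocks us" "written a = blocks vs"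
    and \<rho>: "\<And>\<nu> \<nu>'. regs (Suc r) \<nu> @ vs = us @ regs (Suc r) \<nu>' \<Longrightarrow>
      (\<And>j. Suc r \<le> j \<Longrightarrow> \<nu>' j = \<nu> j) \<Longrightarrow> (\<nu>, \<nu>') \<in> \<rho>"
    by (rule transformsE) blast
  then have "blocks ((e # replicate r 0) @ vs) = blocks (us @ replicate (Suc r) 0)"
    using eq unfolding a(1) blocks_simps(3) blocks_input by simp
  then show ?thesis
    unfolding blocks_inject by (intro \<rho>) (simp_all only: input_registers zero_registers, simp)
qed

theorem halting_queue_language:
  obtains L :: "(bool \<times> bool) list set" where "regular L" "[] \<notin> L"
    "\<And>e z. reval f [e] z \<Longrightarrow> \<exists>w \<in> L. qrun (replicate e False) w []"
    "\<And>e w. w \<in> L \<Longrightarrow> replicate e False @ written w = consumed w \<Longrightarrow> \<exists>z. reval f [e] z"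
proof -
  obtain \<rho> where "program \<rho>"
    and \<rho>: "\<And>e. \<rho> `` {input e} = (if \<exists>z. reval f [e] z then {\<lambda>_. 0} else {})"
    using ex_halting_program by blast
  then obtain r where "counter_prog r \<rho>" by (auto simp: program_def)
  then have "counter_prog (Suc r) \<rho>" by (rule counter_prog_mono) simp
  then obtain A where A: "queue_impl (Suc r) \<rho> A" using counter_prog_queue_impl by blast
  have halts_iff: "(\<exists>z. reval f [e] z) \<longleftrightarrow> (input e, \<lambda>_. 0) \<in> \<rho>" for e
    using \<rho>[of e] by (auto split: if_splits)
  show ?thesis
  proof (rule that)
    show "regular (halting_lang r A)"
      using A unfolding queue_impl_def halting_lang_def by (auto intro!: regular_conc regular_word)
    show "[] \<notin> halting_lang r A" by (auto simp: halting_lang_def conc_def)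
  qed (use A halts_iff halting_lang_complete halting_lang_sound in blast)+
qed

section \<open>Histories of communicating machines\<close>

definition trans_of :: "nat \<times> (bool \<times> nat) \<times> nat \<Rightarrow> trans" where
  "trans_of = (\<lambda>(p, a, q). (p, fst a, snd a, q))"

lemma inj_trans_of: "inj trans_of"
  by (auto simp: inj_def trans_of_def)

definition actor :: "bool \<Rightarrow> nat \<times> nat \<Rightarrow> nat" where
  "actor s e = (if s then fst e else snd e)"

definition effect :: "bool \<Rightarrow> 'b list \<Rightarrow> 'b list \<Rightarrow> 'b list \<Rightarrow> bool" where
  "effect s w x y \<longleftrightarrow> (if s then y = x @ w else x = w @ y)"

lemma effect_Nil: "effect s [] x y \<longleftrightarrow> y = x"
  by (auto simp: effect_def)

lemma effect_append: "effect s (v @ w) x z \<longleftrightarrow> (\<exists>y. effect s v x y \<and> effect s w y z)"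
  by (auto simp: effect_def)

lemma effect_map: "effect s w x y \<Longrightarrow> effect s (map f w) (map f x) (map f y)"
  by (auto simp: effect_def split: if_splits)

lemma step_iff:
  "step n es P (S, C) g \<longleftrightarrow> (\<exists>\<xi> s b q y. \<xi> < length es \<and> actor s (es ! \<xi>) < n \<and> b \<in> msg_of P \<xi> \<and>
    (S ! actor s (es ! \<xi>), s, b, q) \<in> transitions P (actor s (es ! \<xi>)) \<and>
    effect s [b] (C ! \<xi>) y \<and> g = (S[actor s (es ! \<xi>) := q], C[\<xi> := y]))" (is "_ \<longleftrightarrow> ?R")
proof
  assume "step n es P (S, C) g"
  then show ?R
  proof cases
    case (step_send i \<xi> b q)
    then show ?R by - (rule exI[of _ \<xi>], rule exI[of _ True], auto simp: actor_def effect_def)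
  next
    case (step_recv i \<xi> b q w)
    then show ?R by - (rule exI[of _ \<xi>], rule exI[of _ False], auto simp: actor_def effect_def)
  qed
next
  assume ?R
  then obtain \<xi> s b q y where "\<xi> < length es" "actor s (es ! \<xi>) < n" "b \<in> msg_of P \<xi>"
    "(S ! actor s (es ! \<xi>), s, b, q) \<in> transitions P (actor s (es ! \<xi>))"
    "effect s [b] (C ! \<xi>) y" "g = (S[actor s (es ! \<xi>) := q], C[\<xi> := y])" by blast
  then show "step n es P (S, C) g"
    by (cases s) (auto simp: actor_def effect_def intro: step_send step_recv)
qed

definition actions :: "bool \<Rightarrow> nat set \<Rightarrow> (bool \<times> nat) list \<Rightarrow> nat list" where
  "actions s M u = map snd (filter (\<lambda>(s', b). s' = s \<and> b \<in> M) u)"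

lemma actions_simps [simp]:
  "actions s M [] = []"
  "actions s M ((s', b) # u) = (if s' = s \<and> b \<in> M then b # actions s M u else actions s M u)"
  "actions s M (u @ v) = actions s M u @ actions s M v"
  by (auto simp: actions_def)

definition history :: "nat \<Rightarrow> (nat \<times> nat) list \<Rightarrow> protocol \<Rightarrow> nat list \<times> nat list list \<Rightarrow>
    (nat \<Rightarrow> (bool \<times> nat) list) \<Rightarrow> bool" where
  "history n es P g u \<longleftrightarrow> length (fst g) = n \<and> length (snd g) = length es \<and>
    (\<forall>j<n. path (trans_of -` transitions P j) (initial P j) (u j) (fst g ! j)) \<and>
    (\<forall>\<xi><length es. actions True (msg_of P \<xi>) (u (fst (es ! \<xi>))) =
      actions False (msg_of P \<xi>) (u (snd (es ! \<xi>))) @ snd g ! \<xi>)"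

lemma history_initial: "history n es P (initial_global n es P) (\<lambda>_. [])"
  by (auto simp: history_def initial_global_def intro: path_Nil)

lemma history_step:
  assumes disjoint: "\<And>\<xi> \<xi>'. \<xi> \<noteq> \<xi>' \<Longrightarrow> msg_of P \<xi> \<inter> msg_of P \<xi>' = {}"
    and u: "history n es P (S, C) u" and step: "step n es P (S, C) g"
  shows "\<exists>u'. history n es P g u'"
proof -
  obtain \<xi> s b q y where \<xi>: "\<xi> < length es" "actor s (es ! \<xi>) < n" "b \<in> msg_of P \<xi>"
    and trans: "(S ! actor s (es ! \<xi>), s, b, q) \<in> transitions P (actor s (es ! \<xi>))"
    and y: "effect s [b] (C ! \<xi>) y" and g: "g = (S[actor s (es ! \<xi>) := q], C[\<xi> := y])"
    using step unfolding step_iff by blast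
  let ?i = "actor s (es ! \<xi>)"
  let ?u = "u(?i := u ?i @ [(s, b)])"
  have "path (trans_of -` transitions P j) (initial P j) (?u j) (S[?i := q] ! j)" if "j < n" for j
    using u \<xi>(2) trans that
    by (auto simp: history_def trans_of_def nth_list_update intro: path_snoc)
  moreover have "actions True (msg_of P \<xi>') (?u (fst (es ! \<xi>'))) =
      actions False (msg_of P \<xi>') (?u (snd (es ! \<xi>'))) @ C[\<xi> := y] ! \<xi>'" if "\<xi>' < length es" for \<xi>'
    using u \<xi> y that disjoint[of \<xi> \<xi>']
    by (cases "\<xi>' = \<xi>"; cases s) (auto simp: history_def effect_def actor_def)
  ultimately have "history n es P g ?u" using u by (simp add: history_def g)
  then show ?thesis by blast
qed

lemma history_if_reachable:
  assumes "\<And>\<xi> \<xi>'. \<xi> \<noteq> \<xi>' \<Longrightarrow> msg_of P \<xi> \<inter> msg_of P \<xi>' = {}"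
    and "(step n es P)\<^sup>*\<^sup>* (initial_global n es P) g"
  shows "\<exists>u. history n es P g u"
  using assms(2)
proof (induction rule: rtranclp_induct)
  case base
  show ?case using history_initial by blast
next
  case (step g g')
  obtain S C where "g = (S, C)" by (cases g)
  then show ?case using step history_step[OF assms(1)] by blast
qed

section \<open>Protocols on a cycle\<close>

definition msg :: "nat \<Rightarrow> bool \<Rightarrow> nat" where
  "msg \<xi> b = 2 * \<xi> + of_bool b"

lemma msg_div_2: "msg \<xi> b div 2 = \<xi>" and odd_msg: "odd (msg \<xi> b) = b"
  by (auto simp: msg_def)

definition letters :: "bool \<Rightarrow> nat \<Rightarrow> (bool \<times> nat) list \<Rightarrow> bool list" where
  "letters s \<xi> u = map odd (actions s {b. b div 2 = \<xi>} u)"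

lemma letters_Nil: "letters s \<xi> [] = []"
  by (simp add: letters_def)

lemma letters_Cons:
  "letters s \<xi> ((s', msg \<xi>' b) # u) = (if s' = s \<and> \<xi>' = \<xi> then b # letters s \<xi> u else letters s \<xi> u)"
  by (simp add: letters_def msg_div_2 odd_msg)

locale oriented_cycle =
  fixes n :: nat and es :: "(nat \<times> nat) list" and cs vs :: "nat list"
  assumes graph: "graph_ok n es" and cycle: "undirected_cycle es cs vs"
    and orient: "es ! (cs ! 0) = (vs ! 0, vs ! 1) \<or>
      es ! (cs ! (length cs - 1)) = (vs ! (length cs - 1), vs ! length cs)"
begin

abbreviation m :: nat where "m \<equiv> length cs"

definition fwd :: "nat \<Rightarrow> bool" where
  "fwd k \<longleftrightarrow> es ! (cs ! k) = (vs ! k, vs ! Suc k)"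

lemma m_pos: "0 < m"
  using cycle by (auto simp: undirected_cycle_def)

definition last_index :: nat where
  "last_index = m - 1"

lemma Suc_last_index: "Suc last_index = m" and last_index_less: "last_index < m"
  using m_pos by (auto simp: last_index_def)

lemma fwd_first_or_last: "fwd 0 \<or> fwd last_index"
  using orient Suc_last_index by (simp add: fwd_def last_index_def)

lemma edge_less: "k < m \<Longrightarrow> cs ! k < length es"
  using cycle by (auto simp: undirected_cycle_def)

lemma edge_eq_iff: "i < m \<Longrightarrow> j < m \<Longrightarrow> cs ! i = cs ! j \<longleftrightarrow> i = j"
  using cycle by (auto simp: undirected_cycle_def nth_eq_iff_index_eq)

lemma actor_left: "k < m \<Longrightarrow> actor (fwd k) (es ! (cs ! k)) = vs ! k"
  and actor_right: "k < m \<Longrightarrow> actor (\<not> fwd k) (es ! (cs ! k)) = vs ! Suc k"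
  using cycle by (auto simp: undirected_cycle_def fwd_def actor_def)

lemma closed: "vs ! m = vs ! 0"
  using cycle by (auto simp: undirected_cycle_def)

lemma node_less: "k < m \<Longrightarrow> vs ! k < n"
  using graph actor_left[of k] nth_mem[OF edge_less[of k]]
  by (auto simp: graph_ok_def actor_def split: if_splits)

lemma node_eq_iff:
  assumes "i < m" "j < m"
  shows "vs ! i = vs ! j \<longleftrightarrow> i = j"
proof -
  have "length (butlast vs) = m" "distinct (butlast vs)"
    using cycle by (auto simp: undirected_cycle_def)
  then show ?thesis
    using assms nth_eq_iff_index_eq[of "butlast vs" i j] by (simp add: nth_butlast)
qed

lemma inner_node_neq: "Suc k < m \<Longrightarrow> vs ! Suc k \<noteq> vs ! 0"
  using m_pos node_eq_iff[of "Suc k" 0] by simp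

text \<open>The actions, as pairs (send?, message), of the nodes \<open>vs ! k\<close> and \<open>vs ! Suc k\<close> on the edge
  \<open>k\<close> of the cycle that joins them.\<close>

definition left_act :: "nat \<Rightarrow> bool \<Rightarrow> bool \<times> nat" where
  "left_act k b = (fwd k, msg (cs ! k) b)"

definition right_act :: "nat \<Rightarrow> bool \<Rightarrow> bool \<times> nat" where
  "right_act k b = (\<not> fwd k, msg (cs ! k) b)"

lemma letters_act:
  assumes "i < m" "k < m"
  shows "letters s (cs ! i) (left_act k b # u) =
      (if k = i \<and> s = fwd k then b # letters s (cs ! i) u else letters s (cs ! i) u)"
    and "letters s (cs ! i) (right_act k b # u) =
      (if k = i \<and> s = (\<not> fwd k) then b # letters s (cs ! i) u else letters s (cs ! i) u)"
  using assms edge_eq_iff[of k i] by (auto simp: left_act_def right_act_def letters_Cons)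

definition hold :: "bool \<Rightarrow> nat" where
  "hold b = (if b then 2 else 1)"

lemma hold_simps: "hold b \<noteq> 0" "hold b = hold b' \<longleftrightarrow> b = b'"
  by (auto simp: hold_def)

definition copy_automaton :: "nat \<Rightarrow> (nat \<times> (bool \<times> nat) \<times> nat) set" where
  "copy_automaton k = (\<Union>b. {(0, right_act k b, hold b), (hold b, left_act (Suc k) b, 0)})"

definition copy_trans :: "nat \<Rightarrow> trans list" where
  "copy_trans k = concat (map (\<lambda>b. [trans_of (0, right_act k b, hold b),
     trans_of (hold b, left_act (Suc k) b, 0)]) [False, True])"

definition copy_machine :: "nat \<Rightarrow> fsm" where
  "copy_machine j = ([0, 1, 2], 0,
     concat (map copy_trans (filter (\<lambda>k. vs ! Suc k = j) [0..<last_index])))"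

definition queue_act :: "bool \<times> bool \<Rightarrow> bool \<times> nat" where
  "queue_act = (\<lambda>(w, b). if w then left_act 0 b else right_act last_index b)"

definition queue_trans :: "nat \<times> (bool \<times> bool) \<times> nat \<Rightarrow> trans" where
  "queue_trans = trans_of \<circ> (\<lambda>(p, a, q). (p, queue_act a, q))"

definition msgs :: "(nat \<times> nat) list" where
  "msgs = concat (map (\<lambda>\<xi>. [(msg \<xi> False, \<xi>), (msg \<xi> True, \<xi>)]) [0..<length es])"

definition cycle_protocol :: "fsm \<Rightarrow> protocol" where
  "cycle_protocol M = (msgs, map (\<lambda>j. if j = vs ! 0 then M else copy_machine j) [0..<n])"

lemma msg_of_cycle_protocol:
  "msg_of (cycle_protocol M) \<xi> = (if \<xi> < length es then {b. b div 2 = \<xi>} else {})"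
proof -
  have "b = msg (b div 2) False \<or> b = msg (b div 2) True" for b
    unfolding msg_def by simp presburger
  then show ?thesis
    by (auto simp: msg_of_def cycle_protocol_def msgs_def msg_div_2 intro!: bexI[of _ \<xi>])
qed

lemma machine_cycle_protocol:
  "j < n \<Longrightarrow> machine (cycle_protocol M) j = (if j = vs ! 0 then M else copy_machine j)"
  by (simp add: machine_def cycle_protocol_def)

lemma transitions_main: "transitions (cycle_protocol M) (vs ! 0) = set (snd (snd M))"
  using node_less[OF m_pos] by (simp add: transitions_def machine_cycle_protocol)

lemma set_copy_trans: "set (copy_trans k) = trans_of ` copy_automaton k"
  by (auto simp: copy_trans_def copy_automaton_def UNIV_bool)

lemma transitions_copy:
  assumes "Suc k < m"
  shows "transitions (cycle_protocol M) (vs ! Suc k) = trans_of ` copy_automaton k"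
proof -
  have "set (filter (\<lambda>k'. vs ! Suc k' = vs ! Suc k) [0..<last_index]) = {k}"
    using assms by (auto simp: node_eq_iff last_index_def)
  then show ?thesis
    using node_less[OF assms] inner_node_neq[OF assms]
    by (simp add: transitions_def machine_cycle_protocol copy_machine_def set_copy_trans)
qed

lemma initial_copy:
  assumes "Suc k < m"
  shows "initial (cycle_protocol M) (vs ! Suc k) = 0"
  using node_less[OF assms] inner_node_neq[OF assms]
  by (simp add: initial_def machine_cycle_protocol copy_machine_def)

subsection \<open>Stability implies equality of the written and the consumed word\<close>

lemma letters_copy:
  assumes k: "Suc k < m" and "path (copy_automaton k) 0 u 0"
  shows "letters (\<not> fwd k) (cs ! k) u = letters (fwd (Suc k)) (cs ! Suc k) u"
proof -
  have "(p = 0 \<longrightarrow> letters (\<not> fwd k) (cs ! k) u = letters (fwd (Suc k)) (cs ! Suc k) u) \<and>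
      (\<forall>b. p = hold b \<longrightarrow> b # letters (\<not> fwd k) (cs ! k) u = letters (fwd (Suc k)) (cs ! Suc k) u)"
    if "path (copy_automaton k) p u 0" for p
    using that
  proof (induction p u "0 :: nat" rule: path.induct)
    case path_Nil
    show ?case using hold_simps(1) by (auto simp: letters_Nil)
  next
    case (path_Cons p a q u)
    from path_Cons(1) consider b where "p = 0" "a = right_act k b" "q = hold b"
      | b where "p = hold b" "a = left_act (Suc k) b" "q = 0"
      by (auto simp: copy_automaton_def)
    then show ?case
      using path_Cons(3) k by cases (auto simp: letters_act hold_simps)
  qed
  with assms(2) show ?thesis by blast
qed

lemma letters_queue_act_Cons:
  "letters (fwd 0) (cs ! 0) (queue_act (s, b) # u) =
    (if s then b # letters (fwd 0) (cs ! 0) u else letters (fwd 0) (cs ! 0) u)"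
  "letters (\<not> fwd last_index) (cs ! last_index) (queue_act (s, b) # u) =
    (if s then letters (\<not> fwd last_index) (cs ! last_index) u
     else b # letters (\<not> fwd last_index) (cs ! last_index) u)"
  using m_pos last_index_less
  by (cases "last_index = 0"; cases s; simp add: queue_act_def letters_act)+

lemma letters_queue_act:
  "letters (fwd 0) (cs ! 0) (map queue_act w) = written w"
  "letters (\<not> fwd last_index) (cs ! last_index) (map queue_act w) = consumed w"
proof (induction w)
  case (Cons a w)
  obtain s b where "a = (s, b)" by (cases a)
  then show "letters (fwd 0) (cs ! 0) (map queue_act (a # w)) = written (a # w)"
    "letters (\<not> fwd last_index) (cs ! last_index) (map queue_act (a # w)) = consumed (a # w)"
    using Cons by (cases s; simp add: letters_queue_act_Cons)+
qed (simp_all add: letters_Nil)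

lemma path_queue_trans:
  assumes "path (trans_of -` queue_trans ` T) p u q"
  obtains w where "u = map queue_act w" "path T p w q"
proof -
  have "trans_of -` queue_trans ` T = (\<lambda>(p, a, q). (p, queue_act a, q)) ` T"
    unfolding queue_trans_def image_comp[symmetric] by (rule inj_vimage_image_eq[OF inj_trans_of])
  then show ?thesis using assms path_map_labels that by metis
qed

lemma letters_edge:
  assumes u: "history n es (cycle_protocol M) (S, replicate (length es) []) u" and k: "k < m"
  shows "letters (fwd k) (cs ! k) (u (vs ! k)) = letters (\<not> fwd k) (cs ! k) (u (vs ! Suc k))"
proof -
  let ?e = "es ! (cs ! k)"
  have "letters True (cs ! k) (u (fst ?e)) = letters False (cs ! k) (u (snd ?e))"
    using u edge_less[OF k]
    by (simp add: history_def letters_def msg_of_cycle_protocol)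
  then show ?thesis
    using actor_left[OF k] actor_right[OF k] by (cases "fwd k") (simp_all add: actor_def)
qed

theorem stable_imp_written_eq_consumed:
  assumes trans: "set (snd (snd M)) = queue_trans ` T"
    and stable: "stable_cs n es (cycle_protocol M) (replicate n 0)"
  shows "\<exists>w. path T (fst (snd M)) w 0 \<and> written w = consumed w"
proof -
  let ?P = "cycle_protocol M"
  have "msg_of ?P \<xi> \<inter> msg_of ?P \<xi>' = {}" if "\<xi> \<noteq> \<xi>'" for \<xi> \<xi>'
    using that by (auto simp: msg_of_cycle_protocol)
  then obtain u where u: "history n es ?P (replicate n 0, replicate (length es) []) u"
    using history_if_reachable stable unfolding stable_cs_def by blast
  then have path: "path (trans_of -` transitions ?P j) (initial ?P j) (u j) 0" if "j < n" for j
    using that unfolding history_def by auto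
  have "path (trans_of -` queue_trans ` T) (fst (snd M)) (u (vs ! 0)) 0"
    using path[OF node_less[OF m_pos]] node_less[OF m_pos]
    by (simp add: transitions_main trans initial_def machine_cycle_protocol)
  then obtain w where w: "u (vs ! 0) = map queue_act w" "path T (fst (snd M)) w 0"
    by (rule path_queue_trans)
  have "letters (fwd k) (cs ! k) (u (vs ! k)) = written w" if "k < m" for k
    using that
  proof (induction k)
    case 0
    show ?case by (simp add: w(1) letters_queue_act)
  next
    case (Suc k)
    have "path (copy_automaton k) 0 (u (vs ! Suc k)) 0"
      using path[OF node_less[OF Suc.prems]] transitions_copy[OF Suc.prems] initial_copy[OF Suc.prems]
      by (simp add: inj_vimage_image_eq[OF inj_trans_of])
    then show ?case using Suc letters_copy letters_edge[OF u, of k] by simp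
  qed
  then have "letters (\<not> fwd last_index) (cs ! last_index) (u (vs ! 0)) = written w"
    using letters_edge[OF u last_index_less] last_index_less closed Suc_last_index by simp
  with w show ?thesis by (auto simp: letters_queue_act)
qed

subsection \<open>Queue runs imply stability\<close>

definition channels :: "(nat \<Rightarrow> bool list) \<Rightarrow> nat list list" where
  "channels X = map (\<lambda>\<xi>. map (msg \<xi>) (X \<xi>)) [0..<length es]"

lemma channels_update: "\<xi> < length es \<Longrightarrow> (channels X)[\<xi> := map (msg \<xi>) y] = channels (X(\<xi> := y))"
  by (rule nth_equalityI) (auto simp: channels_def nth_list_update)

abbreviation cycle_step :: "fsm \<Rightarrow> nat list \<times> nat list list \<Rightarrow> nat list \<times> nat list list \<Rightarrow> bool"
  where "cycle_step M \<equiv> step n es (cycle_protocol M)"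

abbreviation cycle_steps :: "fsm \<Rightarrow> nat list \<times> nat list list \<Rightarrow> nat list \<times> nat list list \<Rightarrow> bool"
  where "cycle_steps M \<equiv> (cycle_step M)\<^sup>*\<^sup>*"

lemma step_channels:
  assumes "\<xi> < length es" "actor s (es ! \<xi>) = i" "i < n"
    and "(S ! i, s, msg \<xi> b, q) \<in> transitions (cycle_protocol M) i" "effect s [b] (X \<xi>) y"
  shows "cycle_step M (S, channels X) (S[i := q], channels (X(\<xi> := y)))"
proof -
  have "effect s [msg \<xi> b] (channels X ! \<xi>) (map (msg \<xi>) y)"
    using effect_map[OF assms(5), of "msg \<xi>"] assms(1) by (simp add: channels_def)
  moreover have "msg \<xi> b \<in> msg_of (cycle_protocol M) \<xi>"
    using assms(1) by (simp add: msg_of_cycle_protocol msg_div_2)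
  ultimately show ?thesis
    unfolding step_iff channels_update[OF assms(1), symmetric] using assms(1-4) by blast
qed

lemma step_left:
  assumes "k < m" "trans_of (S ! (vs ! k), left_act k b, q) \<in> transitions (cycle_protocol M) (vs ! k)"
    and "effect (fwd k) [b] (X (cs ! k)) y"
  shows "cycle_step M (S, channels X) (S[vs ! k := q], channels (X(cs ! k := y)))"
  using assms edge_less actor_left node_less
  by (intro step_channels) (auto simp: trans_of_def left_act_def)

lemma step_right:
  assumes "k < m" "vs ! Suc k = i"
    and "trans_of (S ! i, right_act k b, q) \<in> transitions (cycle_protocol M) i"
    and "effect (\<not> fwd k) [b] (X (cs ! k)) y"
  shows "cycle_step M (S, channels X) (S[i := q], channels (X(cs ! k := y)))"
proof (rule step_channels)
  show "i < n"
    using assms(1,2) node_less[of "Suc k"] node_less[OF m_pos] closed by (cases "Suc k = m") auto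
qed (use assms edge_less actor_right in \<open>auto simp: trans_of_def right_act_def\<close>)

definition conf :: "nat \<Rightarrow> (nat \<Rightarrow> bool list) \<Rightarrow> nat list \<times> nat list list" where
  "conf p X = ((replicate n 0)[vs ! 0 := p], channels X)"

lemma stable_iff_steps:
  "stable_cs n es (cycle_protocol M) (replicate n 0) \<longleftrightarrow>
    cycle_steps M (conf (fst (snd M)) (\<lambda>_. [])) (conf 0 (\<lambda>_. []))"
proof -
  have "replicate (length es) [] = channels (\<lambda>_. [])"
    by (rule nth_equalityI) (auto simp: channels_def)
  moreover have "map (initial (cycle_protocol M)) [0..<n] = (replicate n 0)[vs ! 0 := fst (snd M)]"
    by (rule nth_equalityI)
      (auto simp: initial_def machine_cycle_protocol copy_machine_def nth_list_update)
  moreover have "(replicate n 0)[vs ! 0 := 0] = replicate n (0 :: nat)"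
    using list_update_id[of "replicate n (0 :: nat)" "vs ! 0"] node_less[OF m_pos] by simp
  ultimately show ?thesis by (simp add: stable_cs_def initial_global_def conf_def)
qed

definition passes :: "fsm \<Rightarrow> nat \<Rightarrow> nat \<Rightarrow> nat \<Rightarrow> bool" where
  "passes M p i j \<longleftrightarrow> (\<forall>X b y z. (\<forall>k. i < k \<and> k < j \<longrightarrow> X (cs ! k) = []) \<longrightarrow>
     effect (\<not> fwd i) [b] (X (cs ! i)) y \<longrightarrow> effect (fwd j) [b] (X (cs ! j)) z \<longrightarrow>
     cycle_steps M (conf p X) (conf p (X(cs ! i := y, cs ! j := z))))"

lemma passesD:
  assumes "passes M p i j" "\<And>k. i < k \<Longrightarrow> k < j \<Longrightarrow> X (cs ! k) = []"
    and "effect (\<not> fwd i) [b] (X (cs ! i)) y" "effect (fwd j) [b] (X (cs ! j)) z"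
  shows "cycle_steps M (conf p X) (conf p (X(cs ! i := y, cs ! j := z)))"
  using assms unfolding passes_def by blast

lemma passes_Suc:
  assumes "Suc k < m"
  shows "passes M p k (Suc k)"
  unfolding passes_def
proof (intro allI impI)
  fix X :: "nat \<Rightarrow> bool list" and b :: bool and y z
  assume y: "effect (\<not> fwd k) [b] (X (cs ! k)) y"
    and z: "effect (fwd (Suc k)) [b] (X (cs ! Suc k)) z"
  let ?i = "vs ! Suc k" and ?S = "(replicate n 0)[vs ! 0 := p]"
  have i: "?i < n" "?i \<noteq> vs ! 0" using node_less[OF assms] inner_node_neq[OF assms] by auto
  have copy: "trans_of (0, right_act k b, hold b) \<in> transitions (cycle_protocol M) ?i"
    "trans_of (hold b, left_act (Suc k) b, 0) \<in> transitions (cycle_protocol M) ?i"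
    unfolding transitions_copy[OF assms] by (auto simp: copy_automaton_def)
  have "cycle_step M (?S, channels X) (?S[?i := hold b], channels (X(cs ! k := y)))"
    using assms i y copy(1) by (intro step_right) auto
  moreover have "cycle_step M (?S[?i := hold b], channels (X(cs ! k := y)))
      (?S[?i := hold b, ?i := 0], channels (X(cs ! k := y, cs ! Suc k := z)))"
    using assms i z copy(2) edge_eq_iff[of "Suc k" k] by (intro step_left) auto
  moreover have "?S[?i := hold b, ?i := 0] = ?S"
    using i list_update_id[of ?S ?i] by simp
  ultimately show "cycle_steps M (conf p X) (conf p (X(cs ! k := y, cs ! Suc k := z)))"
    unfolding conf_def by simp
qed

text \<open>Which of the two parts of the path moves first is dictated by the orientation of the edge
  \<open>j\<close> that joins them.\<close>

lemma passes_trans: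
  assumes ij: "passes M p i j" and jk: "passes M p j k" and less: "i < j" "j < k" "k < m"
  shows "passes M p i k"
  unfolding passes_def
proof (intro allI impI)
  fix X :: "nat \<Rightarrow> bool list" and b :: bool and y z
  assume empty: "\<forall>l. i < l \<and> l < k \<longrightarrow> X (cs ! l) = []"
    and y: "effect (\<not> fwd i) [b] (X (cs ! i)) y" and z: "effect (fwd k) [b] (X (cs ! k)) z"
  have ne: "cs ! l \<noteq> cs ! l'" if "l < l'" "l' \<le> k" for l l'
    using that less(3) edge_eq_iff[of l l'] by simp
  have X_j: "X (cs ! j) = []" using empty less by simp
  show "cycle_steps M (conf p X) (conf p (X(cs ! i := y, cs ! k := z)))"
  proof (cases "fwd j")
    case True
    let ?X = "X(cs ! i := y, cs ! j := [b])"
    have first: "cycle_steps M (conf p X) (conf p ?X)"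
      using passesD[OF ij, of X b y "[b]"] empty y less True X_j by (simp add: effect_def)
    have second: "cycle_steps M (conf p ?X) (conf p (?X(cs ! j := [], cs ! k := z)))"
    proof (rule passesD[OF jk])
      show "?X (cs ! l) = []" if "j < l" "l < k" for l
        using empty that less ne[of i l] ne[of j l] by auto
    qed (use z less True ne[of i k] ne[of j k] in \<open>auto simp: effect_def\<close>)
    have "?X(cs ! j := [], cs ! k := z) = X(cs ! i := y, cs ! k := z)"
      using X_j ne[of i j] less by (auto simp: fun_eq_iff)
    with first second show ?thesis by (metis rtranclp_trans)
  next
    case False
    let ?X = "X(cs ! j := [b], cs ! k := z)"
    have first: "cycle_steps M (conf p X) (conf p ?X)"
      using passesD[OF jk, of X b "[b]" z] empty z less False X_j by (simp add: effect_def)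
    have second: "cycle_steps M (conf p ?X) (conf p (?X(cs ! i := y, cs ! j := [])))"
    proof (rule passesD[OF ij])
      show "?X (cs ! l) = []" if "i < l" "l < j" for l
        using empty that less ne[of l j] ne[of l k] by auto
    qed (use y less False ne[of i j] ne[of i k] ne[of j k] in \<open>auto simp: effect_def\<close>)
    have "?X(cs ! i := y, cs ! j := []) = X(cs ! i := y, cs ! k := z)"
      using X_j ne[of i j] ne[of i k] ne[of j k] less by (auto simp: fun_eq_iff)
    with first second show ?thesis by (metis rtranclp_trans)
  qed
qed

lemma passes_less: "i < j \<Longrightarrow> j < m \<Longrightarrow> passes M p i j"
proof (induction i j rule: less_Suc_induct[consumes 1, case_names Suc trans])
  case (Suc i)
  then show ?case by (rule passes_Suc)
next
  case (trans i j k)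
  then show ?case using passes_trans[of M p i j k] by simp
qed

abbreviation first_edge :: nat where "first_edge \<equiv> cs ! 0"
abbreviation last_edge :: nat where "last_edge \<equiv> cs ! last_index"

lemma first_edge_eq_last_iff: "first_edge = last_edge \<longleftrightarrow> last_index = 0"
  using edge_eq_iff[OF m_pos last_index_less] by auto

lemma steps_pass_word:
  assumes "last_index \<noteq> 0" "\<And>\<xi>. \<xi> \<noteq> first_edge \<Longrightarrow> \<xi> \<noteq> last_edge \<Longrightarrow> X \<xi> = []"
    and "effect (\<not> fwd 0) w (X first_edge) y" "effect (fwd last_index) w (X last_edge) z"
  shows "cycle_steps M (conf p X) (conf p (X(first_edge := y, last_edge := z)))"
  using assms(2-)
proof (induction w arbitrary: X)
  case Nil
  then have "X(first_edge := y, last_edge := z) = X" by (auto simp: effect_Nil)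
  then show ?case by (simp only: rtranclp.rtrancl_refl)
next
  case (Cons b w)
  then obtain y' z' where
    first: "effect (\<not> fwd 0) [b] (X first_edge) y'" "effect (fwd last_index) [b] (X last_edge) z'"
    and rest: "effect (\<not> fwd 0) w y' y" "effect (fwd last_index) w z' z"
    using effect_append[of _ "[b]" w] by auto
  let ?X = "X(first_edge := y', last_edge := z')"
  have "passes M p 0 last_index" using assms(1) last_index_less by (intro passes_less) auto
  then have first: "cycle_steps M (conf p X) (conf p ?X)"
  proof (rule passesD)
    show "X (cs ! k) = []" if "0 < k" "k < last_index" for k
      using that Cons.prems(1)[of "cs ! k"] m_pos last_index_less
        edge_eq_iff[of k 0] edge_eq_iff[of k last_index] by simp
  qed (use first in simp_all)
  have "cycle_steps M (conf p ?X) (conf p (?X(first_edge := y, last_edge := z)))"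
    by (rule Cons.IH) (use Cons.prems(1) rest assms(1) first_edge_eq_last_iff in auto)
  moreover have "?X(first_edge := y, last_edge := z) = X(first_edge := y, last_edge := z)"
    by (auto simp: fun_eq_iff)
  ultimately show ?case using first by (metis rtranclp_trans)
qed

context
  fixes M :: fsm and T :: "(nat \<times> (bool \<times> bool) \<times> nat) set"
  assumes trans: "set (snd (snd M)) = queue_trans ` T"
begin

lemma trans_in_main:
  "(p, a, q) \<in> T \<Longrightarrow> trans_of (p, queue_act a, q) \<in> transitions (cycle_protocol M) (vs ! 0)"
  unfolding transitions_main trans queue_trans_def by force

lemma step_write:
  assumes "(p, (True, b), q) \<in> T" "effect (fwd 0) [b] (X first_edge) y"
  shows "cycle_step M (conf p X) (conf q (X(first_edge := y)))"
  using step_left[OF m_pos, of "(replicate n 0)[vs ! 0 := p]" b q M X y] trans_in_main[OF assms(1)]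
    assms(2) node_less[OF m_pos]
  by (simp add: conf_def queue_act_def)

lemma step_consume:
  assumes "(p, (False, b), q) \<in> T" "effect (\<not> fwd last_index) [b] (X last_edge) y"
  shows "cycle_step M (conf p X) (conf q (X(last_edge := y)))"
  using step_right[OF last_index_less, of "vs ! 0" "(replicate n 0)[vs ! 0 := p]" b q M X y]
    trans_in_main[OF assms(1)] assms(2) closed Suc_last_index node_less[OF m_pos]
  by (simp add: conf_def queue_act_def)

lemma steps_write_directed:
  assumes fwd: "fwd 0" "fwd last_index" and t: "(p, (True, b), q) \<in> T"
  shows "cycle_steps M (conf p ((\<lambda>_. [])(last_edge := x))) (conf q ((\<lambda>_. [])(last_edge := x @ [b])))"
proof -
  let ?X = "(\<lambda>_. [])(last_edge := x)"
  let ?Y = "?X(first_edge := ?X first_edge @ [b])"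
  have "cycle_steps M (conf q ?Y) (conf q ((\<lambda>_. [])(last_edge := x @ [b])))"
  proof (cases "last_index = 0")
    case False
    then have ne: "first_edge \<noteq> last_edge" using first_edge_eq_last_iff by simp
    have "?Y(first_edge := [], last_edge := x @ [b]) = (\<lambda>_. [])(last_edge := x @ [b])"
      using ne by (auto simp: fun_eq_iff)
    moreover have "cycle_steps M (conf q ?Y) (conf q (?Y(first_edge := [], last_edge := x @ [b])))"
      using False ne fwd by (intro steps_pass_word[where w="[b]"]) (auto simp: effect_def)
    ultimately show ?thesis by simp
  qed simp
  moreover have "cycle_step M (conf p ?X) (conf q ?Y)"
    by (rule step_write[OF t]) (simp add: effect_def fwd(1))
  ultimately show ?thesis by (rule converse_rtranclp_into_rtranclp[rotated])
qed

lemma steps_directed: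
  assumes fwd: "fwd 0" "fwd last_index" and "qrun x w x'" "path T p w q"
  shows "cycle_steps M (conf p ((\<lambda>_. [])(last_edge := x))) (conf q ((\<lambda>_. [])(last_edge := x')))"
  using assms(3,4)
proof (induction arbitrary: p rule: qrun.induct)
  case (qrun_Nil x)
  then show ?case by (simp add: path_Nil_iff)
next
  case (qrun_write x b w x')
  from qrun_write.prems obtain r where r: "(p, (True, b), r) \<in> T" "path T r w q"
    by (auto simp: path_Cons_iff)
  show ?case
    using steps_write_directed[OF fwd r(1)] qrun_write.IH[OF r(2)] by (rule rtranclp_trans)
next
  case (qrun_consume x w x' b)
  from qrun_consume.prems obtain r where r: "(p, (False, b), r) \<in> T" "path T r w q"
    by (auto simp: path_Cons_iff)
  have "cycle_step M (conf p ((\<lambda>_. [])(last_edge := b # x)))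
      (conf r (((\<lambda>_. [])(last_edge := b # x))(last_edge := x)))"
    using fwd(2) by (intro step_consume[OF r(1)]) (simp add: effect_def)
  then show ?case
    using qrun_consume.IH[OF r(2)] unfolding fun_upd_upd by (rule converse_rtranclp_into_rtranclp)
qed

lemma step_undirected:
  assumes t: "(p, a, q) \<in> T" and ne: "first_edge \<noteq> last_edge"
    and y: "effect (fwd 0) (written [a]) (X first_edge) y"
    and z: "effect (\<not> fwd last_index) (consumed [a]) (X last_edge) z"
  shows "cycle_step M (conf p X) (conf q (X(first_edge := y, last_edge := z)))"
proof (cases a)
  case (Pair s b)
  show ?thesis
  proof (cases s)
    case True
    then have "z = X last_edge" using z Pair by (simp add: effect_Nil)
    then have "X(first_edge := y, last_edge := z) = X(first_edge := y)"
      using ne by (auto simp: fun_eq_iff)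
    then show ?thesis using step_write[of p b q X y] t y Pair True by simp
  next
    case False
    then have "y = X first_edge" using y Pair by (simp add: effect_Nil)
    then have "X(first_edge := y, last_edge := z) = X(last_edge := z)" by simp
    then show ?thesis using step_consume[of p b q X z] t z Pair False by simp
  qed
qed

lemma steps_undirected:
  assumes ne: "first_edge \<noteq> last_edge" and "path T p w q"
    and "effect (fwd 0) (written w) (X first_edge) y"
    and "effect (\<not> fwd last_index) (consumed w) (X last_edge) z"
  shows "cycle_steps M (conf p X) (conf q (X(first_edge := y, last_edge := z)))"
  using assms(2-)
proof (induction arbitrary: X rule: path.induct)
  case (path_Nil p)
  then have "X(first_edge := y, last_edge := z) = X" by (auto simp: effect_Nil)
  then show ?case by (simp only: rtranclp.rtrancl_refl)
next
  case (path_Cons p a q w r)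
  have "written (a # w) = written [a] @ written w" "consumed (a # w) = consumed [a] @ consumed w"
    by (simp_all flip: written_simps(4) consumed_simps(4))
  then obtain y' z' where
    first: "effect (fwd 0) (written [a]) (X first_edge) y'"
      "effect (\<not> fwd last_index) (consumed [a]) (X last_edge) z'"
    and rest: "effect (fwd 0) (written w) y' y" "effect (\<not> fwd last_index) (consumed w) z' z"
    using path_Cons.prems by (auto simp: effect_append)
  let ?X = "X(first_edge := y', last_edge := z')"
  have "cycle_steps M (conf q ?X) (conf r (?X(first_edge := y, last_edge := z)))"
    using rest ne by (intro path_Cons.IH) simp_all
  moreover have "?X(first_edge := y, last_edge := z) = X(first_edge := y, last_edge := z)"
    by (auto simp: fun_eq_iff)
  ultimately show ?case
    using step_undirected[OF path_Cons.hyps(1) ne first] by (metis converse_rtranclp_into_rtranclp)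
qed

lemma steps_halting_undirected:
  assumes not_directed: "\<not> (fwd 0 \<and> fwd last_index)" and path: "path T p w q"
    and eq: "written w = consumed w"
  shows "cycle_steps M (conf p (\<lambda>_. [])) (conf q (\<lambda>_. []))"
proof -
  let ?E = "\<lambda>_. [] :: bool list"
  let ?W = "?E(first_edge := consumed w, last_edge := consumed w)"
  have "last_index \<noteq> 0" using not_directed fwd_first_or_last by metis
  then have ne: "first_edge \<noteq> last_edge" using first_edge_eq_last_iff by simp
  note run = steps_undirected[OF ne path]
    and pass = steps_pass_word[OF \<open>last_index \<noteq> 0\<close>, where w="consumed w"]
  have empty: "?W(first_edge := [], last_edge := []) = ?E" by (auto simp: fun_eq_iff)
  show ?thesis
  proof (cases "fwd 0")
    case True
    have "cycle_steps M (conf p ?E) (conf q ?W)"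
      using not_directed True eq by (intro run) (auto simp: effect_def)
    moreover have "cycle_steps M (conf q ?W) (conf q (?W(first_edge := [], last_edge := [])))"
      using not_directed True ne by (intro pass) (auto simp: effect_def)
    ultimately show ?thesis unfolding empty by (rule rtranclp_trans)
  next
    case False
    then have "fwd last_index" using fwd_first_or_last by simp
    have "cycle_steps M (conf p ?E) (conf p ?W)"
      using False \<open>fwd last_index\<close> by (intro pass) (auto simp: effect_def)
    moreover have "cycle_steps M (conf p ?W) (conf q (?W(first_edge := [], last_edge := [])))"
      using False \<open>fwd last_index\<close> ne eq by (intro run) (auto simp: effect_def)
    ultimately show ?thesis unfolding empty by (rule rtranclp_trans)
  qed
qed

theorem qrun_imp_stable:
  assumes path: "path T (fst (snd M)) w 0" and qrun: "qrun [] w []"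
  shows "stable_cs n es (cycle_protocol M) (replicate n 0)"
proof (cases "fwd 0 \<and> fwd last_index")
  case True
  have "(\<lambda>_. [])(last_edge := []) = (\<lambda>_. [] :: bool list)" by auto
  then show ?thesis using steps_directed[OF _ _ qrun path] True by (simp add: stable_iff_steps)
next
  case False
  have "written w = consumed w" using qrun_written_consumed[OF qrun] by simp
  then show ?thesis using steps_halting_undirected[OF False path] by (simp add: stable_iff_steps)
qed

end

end

section \<open>Undecidability\<close>

text \<open>The odd states are reserved for the chain that writes the input and ends in state 1, where the
  automaton proper starts.\<close>

definition input_chain :: "nat \<Rightarrow> (nat \<times> (bool \<times> bool) \<times> nat) set" where
  "input_chain e = {(2 * k + 3, (True, False), 2 * k + 1) |k. k < e}"

definition simulation_states :: "nat set" where
  "simulation_states = {p. p = 1 \<or> even p}"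

lemma path_input_chain_iff:
  assumes T: "T \<subseteq> simulation_states \<times> UNIV \<times> simulation_states" and "k \<le> e"
  shows "path (input_chain e \<union> T) (2 * k + 1) w 0 \<longleftrightarrow>
    (\<exists>v. w = replicate k (True, False) @ v \<and> path T 1 v 0)"
  using assms(2)
proof (induction k arbitrary: w)
  case 0
  have "path T p w q" if "path (input_chain e \<union> T) p w q" "p \<in> simulation_states" for p q
    using that
  proof (induction rule: path.induct)
    case (path_Cons p a q w r)
    then have "(p, a, q) \<in> T" by (auto simp: input_chain_def simulation_states_def)
    then show ?case using path_Cons T by (auto intro: path.path_Cons)
  qed (rule path_Nil)
  then show ?case by (auto simp: simulation_states_def intro: path_mono)
next
  case (Suc k)
  have "(2 * Suc k + 1, a, q) \<notin> T" for a q
  proof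
    assume "(2 * Suc k + 1, a, q) \<in> T"
    then have "2 * Suc k + 1 \<in> simulation_states" using T by blast
    then show False by (simp add: simulation_states_def)
  qed
  then have first: "(2 * Suc k + 1, a, q) \<in> input_chain e \<union> T \<longleftrightarrow>
      a = (True, False) \<and> q = 2 * k + 1" for a q
    using Suc.prems by (auto simp: input_chain_def)
  show ?case
  proof (cases w)
    case Nil
    then show ?thesis by (simp add: path_Nil_iff)
  next
    case (Cons a w')
    have "path (input_chain e \<union> T) (2 * Suc k + 1) (a # w') 0 \<longleftrightarrow>
        a = (True, False) \<and> path (input_chain e \<union> T) (2 * k + 1) w' 0"
      unfolding path_Cons_iff first by blast
    then show ?thesis using Suc.IH[of w'] Suc.prems Cons by auto
  qed
qed

context oriented_cycle
begin

definition input_trans :: "nat \<Rightarrow> trans" where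
  "input_trans k = queue_trans (2 * k + 3, (True, False), 2 * k + 1)"

definition simulator :: "nat \<Rightarrow> trans list \<Rightarrow> fsm" where
  "simulator e Ts = (rev [0..<2 * e + 2], 2 * e + 1, rev (map input_trans [0..<e]) @ Ts)"

lemma set_simulator_trans:
  "set Ts = queue_trans ` T \<Longrightarrow> set (snd (snd (simulator e Ts))) = queue_trans ` (input_chain e \<union> T)"
  by (auto simp: simulator_def input_chain_def input_trans_def image_iff)

lemma stable_simulator_iff:
  assumes T: "T \<subseteq> simulation_states \<times> UNIV \<times> simulation_states" and Ts: "set Ts = queue_trans ` T"
    and complete: "halts \<Longrightarrow> \<exists>w. path T 1 w 0 \<and> qrun (replicate e False) w []"
    and sound: "\<And>w. path T 1 w 0 \<Longrightarrow> replicate e False @ written w = consumed w \<Longrightarrow> halts"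
  shows "stable_cs n es (cycle_protocol (simulator e Ts)) (replicate n 0) \<longleftrightarrow> halts"
proof
  let ?input = "map (Pair True) (replicate e False)"
  note trans = set_simulator_trans[OF Ts, of e]
  have path_iff: "path (input_chain e \<union> T) (fst (snd (simulator e Ts))) w 0 \<longleftrightarrow>
      (\<exists>v. w = ?input @ v \<and> path T 1 v 0)" for w
    using path_input_chain_iff[OF T order_refl, of e w] by (simp add: simulator_def)
  show halts if stable: "stable_cs n es (cycle_protocol (simulator e Ts)) (replicate n 0)"
  proof -
    obtain v where v: "path T 1 v 0" "written (?input @ v) = consumed (?input @ v)"
      using stable_imp_written_eq_consumed[OF trans stable] path_iff by metis
    from v(2) show ?thesis by (intro sound[OF v(1)]) (simp del: map_replicate)
  qed
  show "stable_cs n es (cycle_protocol (simulator e Ts)) (replicate n 0)" if halting: halts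
  proof -
    obtain v where v: "path T 1 v 0" "qrun (replicate e False) v []"
      using complete[OF halting] by blast
    have "qrun [] (?input @ v) []"
      using qrun_append[OF qrun_write_all[of "[]" "replicate e False"]] v(2) by simp
    then show ?thesis using v(1) path_iff by (intro qrun_imp_stable[OF trans]) auto
  qed
qed

definition legal_act :: "nat \<Rightarrow> bool \<times> nat \<Rightarrow> bool" where
  "legal_act j a \<longleftrightarrow> snd a div 2 < length es \<and> actor (fst a) (es ! (snd a div 2)) = j"

lemma legal_act_edge:
  assumes "legal_act j (s, b)"
  shows "\<exists>\<xi><length es. b \<in> msg_of (cycle_protocol M) \<xi> \<and>
    (if s then fst (es ! \<xi>) = j else snd (es ! \<xi>) = j)"
proof (intro exI[of _ "b div 2"] conjI)
  show "if s then fst (es ! (b div 2)) = j else snd (es ! (b div 2)) = j"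
    using assms by (cases s) (simp_all add: legal_act_def actor_def)
qed (use assms in \<open>simp_all add: legal_act_def msg_of_cycle_protocol\<close>)

lemma legal_left_act: "k < m \<Longrightarrow> legal_act (vs ! k) (left_act k b)"
  using edge_less actor_left by (simp add: legal_act_def left_act_def msg_div_2)

lemma legal_right_act: "k < m \<Longrightarrow> legal_act (vs ! Suc k) (right_act k b)"
  using edge_less actor_right by (simp add: legal_act_def right_act_def msg_div_2)

lemma legal_queue_act: "legal_act (vs ! 0) (queue_act a)"
  using legal_left_act[OF m_pos] legal_right_act[OF last_index_less] closed Suc_last_index
  by (cases a) (simp add: queue_act_def)

lemma copy_automaton_ok:
  assumes "(p, a, q) \<in> copy_automaton k" "Suc k < m"
  shows "p \<in> {0, 1, 2} \<and> q \<in> {0, 1, 2} \<and> legal_act (vs ! Suc k) a"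
  using assms legal_left_act[of "Suc k"] legal_right_act[of k]
  by (auto simp: copy_automaton_def hold_def)

lemma states_cycle_protocol:
  "j < n \<Longrightarrow> states (cycle_protocol M) j = (if j = vs ! 0 then set (fst M) else {0, 1, 2})"
  by (simp add: states_def machine_cycle_protocol copy_machine_def)

lemma transitions_cycle_protocol:
  "j < n \<Longrightarrow> j \<noteq> vs ! 0 \<Longrightarrow> transitions (cycle_protocol M) j =
    (\<Union>k \<in> {k. Suc k < m \<and> vs ! Suc k = j}. trans_of ` copy_automaton k)"
  by (auto simp: transitions_def machine_cycle_protocol copy_machine_def set_copy_trans
      simp flip: Suc_last_index)

lemma protocol_ok_cycle_protocol:
  assumes init: "fst (snd M) \<in> set (fst M)" and trans: "set (snd (snd M)) = queue_trans ` T"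
    and T: "T \<subseteq> set (fst M) \<times> UNIV \<times> set (fst M)"
  shows "protocol_ok n es (cycle_protocol M)"
proof -
  let ?P = "cycle_protocol M"
  have "p \<in> states ?P j \<and> q \<in> states ?P j \<and> legal_act j (s, b)"
    if j: "j < n" and t: "(p, s, b, q) \<in> transitions ?P j" for j p s b q
  proof (cases "j = vs ! 0")
    case True
    then obtain a where a: "(p, a, q) \<in> T" "fst (queue_act a) = s" "snd (queue_act a) = b"
      using t trans by (auto simp: transitions_main queue_trans_def trans_of_def)
    then have "legal_act j (s, b)"
      using legal_queue_act[of a] True by (simp add: legal_act_def)
    then show ?thesis using T a(1) True j by (auto simp: states_cycle_protocol)
  next
    case False
    then obtain k where "Suc k < m" "vs ! Suc k = j" "(p, (s, b), q) \<in> copy_automaton k"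
      using t j by (auto simp: transitions_cycle_protocol trans_of_def)
    then show ?thesis
      using copy_automaton_ok[of p "(s, b)" q k] False j by (simp add: states_cycle_protocol)
  qed
  moreover have "initial ?P j \<in> states ?P j" if "j < n" for j
    using that init
    by (simp add: initial_def machine_cycle_protocol states_cycle_protocol copy_machine_def)
  moreover have "\<forall>(b, \<xi>) \<in> set (fst ?P). \<xi> < length es" "length (snd ?P) = n"
    by (auto simp: cycle_protocol_def msgs_def)
  moreover have "\<xi> \<noteq> \<xi>' \<longrightarrow> msg_of ?P \<xi> \<inter> msg_of ?P \<xi>' = {}" for \<xi> \<xi>'
    by (auto simp: msg_of_cycle_protocol)
  ultimately show ?thesis
    unfolding protocol_ok_def using legal_act_edge[where M=M] by blast
qed

lemma instance_ok_simulator: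
  assumes Ts: "set Ts = queue_trans ` T" and T: "T \<subseteq> {..e} \<times> UNIV \<times> {..e}"
  shows "instance_ok n es (cycle_protocol (simulator e Ts), replicate n 0)"
proof -
  have states: "set (fst (simulator e Ts)) = {..<2 * e + 2}"
    by (auto simp: simulator_def simp del: upt_Suc)
  have "protocol_ok n es (cycle_protocol (simulator e Ts))"
  proof (rule protocol_ok_cycle_protocol[OF _ set_simulator_trans[OF Ts]])
    show "fst (snd (simulator e Ts)) \<in> set (fst (simulator e Ts))"
      unfolding states by (simp add: simulator_def)
    show "input_chain e \<union> T \<subseteq> set (fst (simulator e Ts)) \<times> UNIV \<times> set (fst (simulator e Ts))"
      unfolding states using T by (auto simp: input_chain_def)
  qed
  then show ?thesis
    by (simp add: instance_ok_def composite_state_def states_cycle_protocol states)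
qed

text \<open>The number \<open>e\<close> plays three roles: the code of the transitions of the simulating automaton,
  a bound on its states, and its input.\<close>

definition simulator_code :: "nat \<Rightarrow> nat" where
  "simulator_code e = list_encode [list_encode (rev [0..<2 * e + 2]), 2 * e + 1,
     list_encode (rev (map (\<lambda>k. enc_trans (input_trans k)) [0..<e]) @ list_decode e)]"

definition instance_code :: "nat \<Rightarrow> nat" where
  "instance_code e = prod_encode (list_encode [list_encode (map prod_encode msgs),
     list_encode (map (\<lambda>j. if j = vs ! 0 then simulator_code e
       else enc_fsm (copy_machine j)) [0..<n])],
     list_encode (replicate n 0))"

lemma enc_instance_simulator:
  assumes "e = list_encode (map enc_trans Ts)"
  shows "enc_instance (cycle_protocol (simulator e Ts), replicate n 0) = instance_code e"
proof -
  have "enc_fsm (simulator e Ts) = simulator_code e"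
    using assms
    by (simp add: enc_fsm_def simulator_def simulator_code_def rev_map comp_def
        del: upt_Suc list_encode.simps)
  then have "map (enc_fsm \<circ> (\<lambda>j. if j = vs ! 0 then simulator e Ts else copy_machine j)) [0..<n] =
      map (\<lambda>j. if j = vs ! 0 then simulator_code e else enc_fsm (copy_machine j)) [0..<n]"
    by simp
  then show ?thesis
    unfolding enc_instance_def enc_protocol_def instance_code_def cycle_protocol_def fst_conv snd_conv
      map_map by (rule arg_cong)
qed

lemma computable_simulator_code: "computable 1 (\<lambda>xs. simulator_code (xs ! 0))"
proof -
  have proj: "computable 1 (\<lambda>xs. xs ! 0)" by (rule computable_proj) simp
  have affine: "computable 1 (\<lambda>xs. 2 * xs ! 0 + c)" for c
    unfolding mult_2 by (intro computable_add computable_const proj)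
  have states: "computable 1 (\<lambda>xs. list_encode (rev [0..<2 * xs ! 0 + 2]))"
    using computable_list_encode_rev_map_upt[where G="\<lambda>k. k" and L="\<lambda>_. []", OF affine[of 2] _ proj]
    by (simp add: computable_const del: upt_Suc)
  have "enc_trans (input_trans k) =
      list_encode [2 * k + 3, if fwd 0 then 1 else 0, msg (cs ! 0) False, 2 * k + 1]" for k
    by (simp add: enc_trans_def input_trans_def queue_trans_def trans_of_def queue_act_def
        left_act_def)
  then have "computable 1 (\<lambda>xs. enc_trans (input_trans (xs ! 0)))"
    unfolding list_encode.simps
    by (simp only:) (intro computable_Suc computable_prod_encode computable_const affine)
  then have "computable 1 (\<lambda>xs.
      list_encode (rev (map (\<lambda>k. enc_trans (input_trans k)) [0..<xs ! 0]) @ list_decode (xs ! 0)))"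
    using proj by (intro computable_list_encode_rev_map_upt) simp_all
  then show ?thesis
    unfolding simulator_code_def list_encode.simps
    by (intro computable_Suc computable_prod_encode computable_const states affine)
qed

lemma computable_instance_code: "computable 1 (\<lambda>xs. instance_code (xs ! 0))"
proof -
  have "computable 1 (\<lambda>xs. list_encode (map (\<lambda>j. if j = vs ! 0 then simulator_code (xs ! 0)
      else enc_fsm (copy_machine j)) [0..<n]))"
    by (intro computable_list_encode computable_if computable_simulator_code computable_const)
  then show ?thesis
    unfolding instance_code_def list_encode.simps(2)[of _ "[_]"] list_encode.simps(2)[of _ "[]"]
    by (intro computable_Suc computable_prod_encode computable_const)
qed

lemma le_enc_queue_trans:
  "p \<le> enc_trans (queue_trans (p, a, q))" "q \<le> enc_trans (queue_trans (p, a, q))"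
  unfolding queue_trans_def comp_def trans_of_def enc_trans_def prod.case
  by (intro le_list_encode; simp del: list_encode.simps)+

lemma ex_halting_instance:
  "\<exists>e x. instance_ok n es x \<and> enc_instance x = instance_code e \<and>
    (stable_cs n es (fst x) (snd x) \<longleftrightarrow> (\<exists>z. reval g [e] z))"
proof -
  obtain L :: "(bool \<times> bool) list set" where L: "regular L" "[] \<notin> L"
    "\<And>e z. reval g [e] z \<Longrightarrow> \<exists>w \<in> L. qrun (replicate e False) w []"
    "\<And>e w. w \<in> L \<Longrightarrow> replicate e False @ written w = consumed w \<Longrightarrow> \<exists>z. reval g [e] z"
    using halting_queue_language[of g] by blast
  have "infinite (range (\<lambda>k :: nat. 2 * k))" by (simp add: finite_image_iff inj_def)
  then have "infinite simulation_states"
    by (rule infinite_super[rotated]) (auto simp: simulation_states_def)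
  then obtain T where T: "finite T" "T \<subseteq> simulation_states \<times> UNIV \<times> simulation_states"
    "\<And>w. path T 1 w 0 \<longleftrightarrow> w \<in> L"
    using regular_automaton[OF L(1,2), of simulation_states 1 0]
    by (auto simp: simulation_states_def)
  obtain ts where ts: "set ts = T" using finite_list[OF T(1)] by blast
  define Ts where "Ts = map queue_trans ts"
  define e where "e = list_encode (map enc_trans Ts)"
  have Ts: "set Ts = queue_trans ` T" by (simp add: Ts_def ts)
  have "p \<le> e \<and> q \<le> e" if "(p, a, q) \<in> T" for p a q
  proof -
    have "enc_trans (queue_trans (p, a, q)) \<le> e"
      unfolding e_def using that Ts by (intro le_list_encode) auto
    then show ?thesis using le_enc_queue_trans le_trans by blast
  qed
  then have "instance_ok n es (cycle_protocol (simulator e Ts), replicate n 0)"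
    by (intro instance_ok_simulator[OF Ts]) auto
  moreover have "stable_cs n es (cycle_protocol (simulator e Ts)) (replicate n 0) \<longleftrightarrow>
      (\<exists>z. reval g [e] z)"
    by (rule stable_simulator_iff[OF T(2) Ts]) (use L(3,4) T(3) in blast)+
  ultimately show ?thesis
    using enc_instance_simulator[OF e_def]
    by (intro exI[of _ e] exI[of _ "(cycle_protocol (simulator e Ts), replicate n 0)"]) simp
qed

theorem stable_undecidable:
  "\<not> decidable_on enc_instance (instance_ok n es) (\<lambda>x. stable_cs n es (fst x) (snd x))"
  using computable_instance_code ex_halting_instance by (rule undecidable_if_halting_instances)

end

lemma undirected_cycle_rev:
  assumes "undirected_cycle es cs vs"
  shows "undirected_cycle es (rev cs) (rev vs)"
proof -
  let ?m = "length cs"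
  have cycle: "cs \<noteq> []" "length vs = Suc ?m" "vs ! 0 = vs ! ?m" "distinct (butlast vs)"
    and edge: "\<And>k. k < ?m \<Longrightarrow> es ! (cs ! k) = (vs ! k, vs ! Suc k) \<or>
      es ! (cs ! k) = (vs ! Suc k, vs ! k)"
    using assms by (auto simp: undirected_cycle_def)
  obtain a ys b where vs: "vs = a # ys @ [b]"
    using cycle(1,2) by (cases vs; cases "tl vs" rule: rev_cases) auto
  then have "?m = Suc (length ys)" using cycle(2) by simp
  then have "a = b" using cycle(3) vs by (simp add: nth_append)
  then have "distinct (butlast (rev vs))" using cycle(4) vs by (simp add: butlast_append)
  moreover have "es ! (rev cs ! k) = (rev vs ! k, rev vs ! Suc k) \<or>
      es ! (rev cs ! k) = (rev vs ! Suc k, rev vs ! k)" if "k < ?m" for k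
  proof -
    have "rev cs ! k = cs ! (?m - Suc k)" "rev vs ! k = vs ! Suc (?m - Suc k)"
      "rev vs ! Suc k = vs ! (?m - Suc k)"
      using that cycle(2) by (auto simp: rev_nth Suc_diff_Suc)
    then show ?thesis using edge[of "?m - Suc k"] that by auto
  qed
  moreover have "rev vs ! 0 = rev vs ! length (rev cs)" using cycle(2,3) by (simp add: rev_nth)
  ultimately show ?thesis using assms unfolding undirected_cycle_def by auto
qed

lemma ex_oriented_cycle:
  assumes "graph_ok n es" "undirected_cycle es cs vs"
  shows "\<exists>cs vs. oriented_cycle n es cs vs"
proof (cases "es ! (cs ! (length cs - 1)) = (vs ! (length cs - 1), vs ! length cs)")
  case True
  then have "oriented_cycle n es cs vs" using assms by unfold_locales auto
  then show ?thesis by blast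
next
  case False
  obtain k where k: "length cs = Suc k" "length vs = Suc (Suc k)"
    using assms(2) by (cases cs) (auto simp: undirected_cycle_def)
  then have "es ! (cs ! k) = (vs ! Suc k, vs ! k)"
    using assms(2) False by (force simp: undirected_cycle_def)
  then have "es ! (rev cs ! 0) = (rev vs ! 0, rev vs ! 1)" using k by (simp add: rev_nth)
  then have "oriented_cycle n es (rev cs) (rev vs)"
    using assms(1) undirected_cycle_rev[OF assms(2)] by unfold_locales auto
  then show ?thesis by blast
qed

theorem theorem7p2:
  fixes n :: nat and es :: "(nat \<times> nat) list"
  assumes "graph_ok n es"
    and "has_undirected_cycle es"
  shows "\<not> decidable_on enc_instance (instance_ok n es)
            (\<lambda>x. stable_cs n es (fst x) (snd x))"
proof -
  obtain cs vs where "oriented_cycle n es cs vs"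
    using assms ex_oriented_cycle unfolding has_undirected_cycle_def by blast
  then show ?thesis by (rule oriented_cycle.stable_undecidable)
qed

end
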